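(* Let $M$ be a polyhedral map with $n$ vertices and let $K$ be its dual map. Then the edge graph $EG(K)$ contains a proper tree if and only if $EG(K)$ contains a proper graph of type-II.
   Context: A map on a surface is an embedding of a finite simple graph in a connected closed surface such that the closure of each complementary component is a $p$-gonal 2-disc ($p\ge3$), the faces; it is polyhedral if any two faces meet in the empty set, a vertex or an edge. $EG(\cdot)$ is the edge graph. The dual map $K$ of $M$ has one vertex per face of $M$ and, for each edge of $M$, an edge joining the vertices of the two faces containing it; faces of $K$ correspond to vertices of $M$. Write $V_K,E_K,F_K$ for vertices, edges, faces of $K$; for a face $F$ of $K$ and an edge set $E$, $F\cap E$ is the set of edges of $E$ on the boundary of $F$. A tree $T$ in $EG(K)$ with vertex set $\{v_1,\dots,v_k\}$ is a proper tree if: (1) $\sum_{i=1}^k\deg(v_i)=n+2(k-1)$, degrees taken in $EG(K)$; (2) whenever two vertices $u_1,u_2$ of $T$ lie on a face $F$ of $K$, a path joining them in the boundary of $F$ is a subtree of $T$; (3) any path in $T$ lying in a face $F$ of $K$ has length at most $q-2$, where $q$ is the length of the boundary of $F$. A subgraph $G=(V,E)$ of $EG(K)$ is admissible if: (1) $|E|=n$; (2) for each face $F$ of $K$, $F\cap E$ consists of exactly two edges; (3) there is a sequence of $n$ faces $F_1,\dots,F_n$ of $K$ with $F_i\cap F_{i+1}\in E$ for $1\le i\le n-1$ and $F_1\cap F_n\in E$. An admissible $G$ is a proper graph of type-II if $(V_K,E_K\setminus E)$ has exactly two connected components, one of which is a proper tree. *)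

theory Defs
  imports "HOL-Analysis.Analysis"
begin

section \<open>Maps on closed surfaces\<close>

text \<open>Second countability is automatic for compact locally Euclidean spaces.\<close>

definition connected_closed_surface :: "'a topology \<Rightarrow> bool" where
  "connected_closed_surface X \<longleftrightarrow>
     topspace X \<noteq> {} \<and> compact_space X \<and> connected_space X \<and> Hausdorff_space X \<and>
     (\<forall>x\<in>topspace X. \<exists>U. openin X U \<and> x \<in> U \<and>
        subtopology X U homeomorphic_space (euclidean :: complex topology))"

text \<open>
  A graph drawn in \<open>X\<close> is given by its vertices (points of \<open>X\<close>) and its edges
  (arcs in \<open>X\<close>, as point sets). Since an arc meets \<open>V\<close> exactly in its two ends, the
  end set of an edge \<open>e\<close> is \<open>e \<inter> V\<close>. There are no loops because \<open>g\<close> is injective,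
  and no multiple edges by the last conjunct.
\<close>

definition embedded_simple_graph :: "'a topology \<Rightarrow> 'a set \<Rightarrow> 'a set set \<Rightarrow> bool" where
  "embedded_simple_graph X V E \<longleftrightarrow>
     finite V \<and> V \<subseteq> topspace X \<and> finite E \<and>
     (\<forall>e\<in>E. \<exists>g :: real \<Rightarrow> 'a. embedding_map (top_of_set {0..1}) X g \<and>
        g ` {0..1} = e \<and> e \<inter> V = {g 0, g 1}) \<and>
     (\<forall>e\<in>E. \<forall>f\<in>E. e \<noteq> f \<longrightarrow> e \<inter> f \<subseteq> V \<and> e \<inter> V \<noteq> f \<inter> V)"

definition complementary_components :: "'a topology \<Rightarrow> 'a set \<Rightarrow> 'a set set \<Rightarrow> 'a set set" where
  "complementary_components X V E =
     connected_components_of (subtopology X (topspace X - (V \<union> \<Union>E)))"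

definition map_faces :: "'a topology \<Rightarrow> 'a set \<Rightarrow> 'a set set \<Rightarrow> 'a set set" where
  "map_faces X V E = (\<lambda>C. X closure_of C) ` complementary_components X V E"

text \<open>
  The closure of \<open>C\<close> is a closed disc with interior \<open>C\<close> whose boundary circle, cut at the
  \<open>p\<close>-th roots of unity, consists of \<open>p\<close> vertices and \<open>p\<close> edges of the graph.
\<close>

definition polygonal_disc :: "'a topology \<Rightarrow> 'a set \<Rightarrow> 'a set set \<Rightarrow> nat \<Rightarrow> 'a set \<Rightarrow> bool" where
  "polygonal_disc X V E p C \<longleftrightarrow>
     (\<exists>h :: complex \<Rightarrow> 'a. embedding_map (top_of_set (cball 0 1)) X h \<and>
        h ` cball 0 1 = X closure_of C \<and> h ` ball 0 1 = C \<and>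
        (\<forall>j<p. h (cis (2 * pi * real j / real p)) \<in> V \<and>
               h ` cis ` {2 * pi * real j / real p .. 2 * pi * real (Suc j) / real p} \<in> E))"

definition map_on_surface :: "'a topology \<Rightarrow> 'a set \<Rightarrow> 'a set set \<Rightarrow> bool" where
  "map_on_surface X V E \<longleftrightarrow>
     connected_closed_surface X \<and> embedded_simple_graph X V E \<and>
     (\<forall>C\<in>complementary_components X V E. \<exists>p\<ge>3. polygonal_disc X V E p C)"

definition polyhedral_map :: "'a topology \<Rightarrow> 'a set \<Rightarrow> 'a set set \<Rightarrow> bool" where
  "polyhedral_map X V E \<longleftrightarrow>
     map_on_surface X V E \<and>
     (\<forall>F\<in>map_faces X V E. \<forall>F'\<in>map_faces X V E. F \<noteq> F' \<longrightarrow>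
        F \<inter> F' = {} \<or> (\<exists>v\<in>V. F \<inter> F' = {v}) \<or> F \<inter> F' \<in> E)"

text \<open>
  \<open>\<phi>\<close>, \<open>\<psi>\<close>, \<open>\<theta>\<close> send faces, edges and vertices of the map to the dual vertices, edges and
  faces. The dual edge of \<open>e\<close> joins the duals of the faces containing \<open>e\<close>, and the
  boundary of the dual face of \<open>v\<close> consists of the duals of the edges at \<open>v\<close>.
\<close>

definition is_dual_map ::
    "'a topology \<Rightarrow> 'a set \<Rightarrow> 'a set set \<Rightarrow> 'a set \<Rightarrow> 'a set set \<Rightarrow> bool" where
  "is_dual_map X V E VK EK \<longleftrightarrow>
     map_on_surface X VK EK \<and>
     (\<exists>\<phi> \<psi> \<theta>.
        bij_betw \<phi> (map_faces X V E) VK \<and> bij_betw \<psi> E EK \<and> bij_betw \<theta> V (map_faces X VK EK) \<and>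
        (\<forall>e\<in>E. \<psi> e \<inter> VK = \<phi> ` {F \<in> map_faces X V E. e \<subseteq> F}) \<and>
        (\<forall>v\<in>V. \<forall>e\<in>E. \<psi> e \<subseteq> \<theta> v \<longleftrightarrow> v \<in> e))"

section \<open>Subgraphs, paths and trees\<close>

text \<open>
  A subgraph is given by a vertex set \<open>W\<close> and a set \<open>A\<close> of edges whose ends lie in \<open>W\<close>; inside
  it, the end set of an edge \<open>e\<close> is \<open>e \<inter> W\<close>. As the graphs are simple, paths and cycles are
  given by their vertex sequences.
\<close>

definition subgraph_of :: "'a set \<Rightarrow> 'a set set \<Rightarrow> 'a set \<Rightarrow> 'a set set \<Rightarrow> bool" where
  "subgraph_of W A V E \<longleftrightarrow> W \<subseteq> V \<and> A \<subseteq> E \<and> (\<forall>e\<in>A. e \<inter> V \<subseteq> W)"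

definition adjacent_in :: "'a set \<Rightarrow> 'a set set \<Rightarrow> 'a \<Rightarrow> 'a \<Rightarrow> bool" where
  "adjacent_in W A x y \<longleftrightarrow> x \<noteq> y \<and> (\<exists>e\<in>A. e \<inter> W = {x, y})"

definition path_in :: "'a set \<Rightarrow> 'a set set \<Rightarrow> 'a list \<Rightarrow> bool" where
  "path_in W A xs \<longleftrightarrow> xs \<noteq> [] \<and> distinct xs \<and> set xs \<subseteq> W \<and>
     (\<forall>i. Suc i < length xs \<longrightarrow> adjacent_in W A (xs ! i) (xs ! Suc i))"

definition path_length :: "'a list \<Rightarrow> nat" where
  "path_length xs = length xs - 1"

definition connected_graph :: "'a set \<Rightarrow> 'a set set \<Rightarrow> bool" where
  "connected_graph W A \<longleftrightarrow> W \<noteq> {} \<and>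
     (\<forall>u\<in>W. \<forall>v\<in>W. \<exists>xs. path_in W A xs \<and> hd xs = u \<and> last xs = v)"

definition cycle_in :: "'a set \<Rightarrow> 'a set set \<Rightarrow> 'a list \<Rightarrow> bool" where
  "cycle_in W A xs \<longleftrightarrow> path_in W A xs \<and> length xs \<ge> 3 \<and> adjacent_in W A (last xs) (hd xs)"

definition tree_graph :: "'a set \<Rightarrow> 'a set set \<Rightarrow> bool" where
  "tree_graph W A \<longleftrightarrow> connected_graph W A \<and> (\<nexists>xs. cycle_in W A xs)"

definition degree_in :: "'a set set \<Rightarrow> 'a \<Rightarrow> nat" where
  "degree_in E v = card {e \<in> E. v \<in> e}"

definition graph_components :: "'a set \<Rightarrow> 'a set set \<Rightarrow> ('a set \<times> 'a set set) set" where
  "graph_components W A =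
     (\<lambda>u. let C = {v \<in> W. \<exists>xs. path_in W A xs \<and> hd xs = u \<and> last xs = v}
          in (C, {e \<in> A. e \<inter> W \<subseteq> C})) ` W"

section \<open>Proper trees and proper graphs of type II\<close>

text \<open>
  Below, \<open>(V, E)\<close> is the edge graph of a map on \<open>X\<close>. An edge lies on the boundary of a face \<open>F\<close>
  iff it is contained in the closed disc \<open>F\<close>, because the interior of \<open>F\<close> is disjoint from
  the graph.
\<close>

definition boundary_verts :: "'a set \<Rightarrow> 'a set \<Rightarrow> 'a set" where
  "boundary_verts V F = V \<inter> F"

definition boundary_edges :: "'a set set \<Rightarrow> 'a set \<Rightarrow> 'a set set" where
  "boundary_edges E F = {e \<in> E. e \<subseteq> F}"

definition proper_tree ::
    "'a topology \<Rightarrow> 'a set \<Rightarrow> 'a set set \<Rightarrow> nat \<Rightarrow> 'a set \<Rightarrow> 'a set set \<Rightarrow> bool" where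
  "proper_tree X V E n W A \<longleftrightarrow>
     subgraph_of W A V E \<and> tree_graph W A \<and>
     (\<Sum>v\<in>W. degree_in E v) = n + 2 * (card W - 1) \<and>
     (\<forall>F\<in>map_faces X V E. \<forall>u1\<in>W \<inter> F. \<forall>u2\<in>W \<inter> F.
        \<exists>xs. hd xs = u1 \<and> last xs = u2 \<and>
             path_in (boundary_verts V F) (boundary_edges E F) xs \<and> path_in W A xs) \<and>
     (\<forall>F\<in>map_faces X V E. \<forall>xs.
        path_in W A xs \<and> path_in (boundary_verts V F) (boundary_edges E F) xs \<longrightarrow>
        int (path_length xs) \<le> int (card (boundary_edges E F)) - 2)"

text \<open>The faces in the cyclic sequence are pairwise distinct.\<close>

definition admissible_graph ::
    "'a topology \<Rightarrow> 'a set \<Rightarrow> 'a set set \<Rightarrow> nat \<Rightarrow> 'a set \<Rightarrow> 'a set set \<Rightarrow> bool" where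
  "admissible_graph X V E n W A \<longleftrightarrow>
     subgraph_of W A V E \<and> card A = n \<and>
     (\<forall>F\<in>map_faces X V E. card (boundary_edges A F) = 2) \<and>
     (\<exists>Fs. length Fs = n \<and> distinct Fs \<and> set Fs \<subseteq> map_faces X V E \<and>
        (\<forall>i. Suc i < n \<longrightarrow> Fs ! i \<inter> Fs ! Suc i \<in> A) \<and> Fs ! 0 \<inter> Fs ! (n - 1) \<in> A)"

definition proper_graph_type_II ::
    "'a topology \<Rightarrow> 'a set \<Rightarrow> 'a set set \<Rightarrow> nat \<Rightarrow> 'a set \<Rightarrow> 'a set set \<Rightarrow> bool" where
  "proper_graph_type_II X V E n W A \<longleftrightarrow>
     admissible_graph X V E n W A \<and>
     card (graph_components V (E - A)) = 2 \<and>
     (\<exists>(C, B)\<in>graph_components V (E - A). proper_tree X V E n C B)"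

end

theory Submission
  imports Defs
begin

text \<open>
  For a proper tree \<open>T = (W, A)\<close> in \<open>K\<close>, the set \<open>D\<close> of edges with exactly one end in \<open>W\<close> is the
  required graph of type II. Conditions (2) and (3) say that \<open>T\<close> meets the boundary of a face \<open>F\<close>
  in a single arc that leaves out at least one vertex; hence \<open>T\<close> is induced, a face that meets
  \<open>T\<close> has exactly two edges in \<open>D\<close>, and its vertices outside \<open>T\<close> form an arc too. The degree
  sum gives \<open>card D = n\<close>, and counting incidences of \<open>D\<close> with faces shows that all \<open>n\<close> faces
  meet \<open>T\<close>. The faces meeting a subtree are connected through its cut edges, by induction on the
  subtree: when the leaf \<open>v\<close> is added along the edge \<open>e\<close>, a crossing of \<open>e\<close> is replaced by a walk
  the other way round \<open>v\<close>. So the faces with the edges of \<open>D\<close> form a connected 2-regular graph,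
  that is, a single cycle, and following it along the outer arcs joins all vertices outside \<open>W\<close>.
\<close>

section \<open>Chains and Hamiltonian cycles\<close>

text \<open>A walk that returns to a visited element is cut back to that visit, so reachability
  already yields a chain without repetitions, as \<open>path_in\<close> demands.\<close>

lemma distinct_chain_of_rtrancl:
  assumes "(u, v) \<in> R\<^sup>*"
  obtains xs where "xs \<noteq> []" "distinct xs" "hd xs = u" "last xs = v"
    "\<forall>i. Suc i < length xs \<longrightarrow> (xs ! i, xs ! Suc i) \<in> R"
proof -
  from assms have "\<exists>xs. xs \<noteq> [] \<and> distinct xs \<and> hd xs = u \<and> last xs = v \<and>
      (\<forall>i. Suc i < length xs \<longrightarrow> (xs ! i, xs ! Suc i) \<in> R)"
  proof (induction rule: rtrancl_induct)
    case base
    show ?case by (rule exI[of _ "[u]"]) auto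
  next
    case (step y z)
    then obtain xs where xs: "xs \<noteq> []" "distinct xs" "hd xs = u" "last xs = y"
      "\<forall>i. Suc i < length xs \<longrightarrow> (xs ! i, xs ! Suc i) \<in> R" by blast
    show ?case
    proof (cases "z \<in> set xs")
      case True
      then obtain k where k: "k < length xs" "xs ! k = z" by (auto simp: in_set_conv_nth)
      have "last (take (Suc k) xs) = z"
        using k by (simp add: take_Suc_conv_app_nth)
      then show ?thesis
        using xs by (intro exI[of _ "take (Suc k) xs"]) auto
    next
      case False
      have "(xs @ [z]) ! i = y" if "Suc i = length xs" for i
        using xs that[symmetric] by (simp add: nth_append last_conv_nth)
      then show ?thesis
        using xs False step.hyps(2)
        by (intro exI[of _ "xs @ [z]"]) (auto simp: nth_append less_Suc_eq)
    qed
  qed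
  then show ?thesis using that by blast
qed

lemma rtrancl_of_chain:
  assumes "xs \<noteq> []" "\<And>i. Suc i < length xs \<Longrightarrow> (xs ! i, xs ! Suc i) \<in> R"
  shows "(hd xs, last xs) \<in> R\<^sup>*"
proof -
  have "i < length xs \<Longrightarrow> (xs ! 0, xs ! i) \<in> R\<^sup>*" for i
    by (induction i) (auto intro: assms(2) rtrancl_into_rtrancl)
  from this[of "length xs - 1"] show ?thesis
    using assms(1) by (simp add: hd_conv_nth last_conv_nth)
qed

lemma rtrancl_closed:
  assumes "(x, y) \<in> R\<^sup>*" "x \<in> S" "\<And>a b. (a, b) \<in> R \<Longrightarrow> a \<in> S \<Longrightarrow> b \<in> S"
  shows "y \<in> S"
  using assms(1,2) by (induction rule: rtrancl_induct) (auto intro: assms(3))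

lemma path_in_iff_chain:
  "path_in W A xs \<longleftrightarrow> xs \<noteq> [] \<and> distinct xs \<and> set xs \<subseteq> W \<and>
    (\<forall>i. Suc i < length xs \<longrightarrow> (xs ! i, xs ! Suc i) \<in> {(x, y). adjacent_in W A x y})"
  by (simp add: path_in_def)

text \<open>Connectivity is handled below through reflexive transitive closures and translated to
  paths here. The hypothesis \<open>u \<in> W\<close> covers the one-vertex path; every later vertex
  is in \<open>W\<close> because adjacency puts it there.\<close>

lemma path_in_joins_iff:
  assumes "u \<in> W"
  shows "(\<exists>xs. path_in W A xs \<and> hd xs = u \<and> last xs = v) \<longleftrightarrow>
    (u, v) \<in> {(x, y). adjacent_in W A x y}\<^sup>*" (is "?l \<longleftrightarrow> (_, _) \<in> ?R\<^sup>*")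
proof
  assume ?l
  then show "(u, v) \<in> ?R\<^sup>*" unfolding path_in_iff_chain using rtrancl_of_chain by blast
next
  assume "(u, v) \<in> ?R\<^sup>*"
  then obtain xs where xs: "xs \<noteq> []" "distinct xs" "hd xs = u" "last xs = v"
    "\<forall>i. Suc i < length xs \<longrightarrow> (xs ! i, xs ! Suc i) \<in> ?R"
    by (rule distinct_chain_of_rtrancl)
  have "xs ! i \<in> W" if "i < length xs" for i
  proof (cases i)
    case 0 then show ?thesis using xs assms by (simp add: hd_conv_nth)
  next
    case (Suc j)
    then have "adjacent_in W A (xs ! j) (xs ! i)" using xs(5) that by auto
    then show ?thesis by (auto simp: adjacent_in_def)
  qed
  then have "set xs \<subseteq> W" by (auto simp: in_set_conv_nth)
  then show ?l unfolding path_in_iff_chain using xs by blast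
qed

text \<open>A longest chain closes up: its last element has both neighbours on the chain, and the
  one that is not its predecessor can only be the first element, since inner elements already have
  their two neighbours. The closed chain admits no exit along \<open>R\<close>, so connectedness
  makes it all of \<open>S\<close>.\<close>

lemma connected_two_regular_Hamiltonian:
  fixes R :: "'b rel"
  assumes fin: "finite S" and ne: "S \<noteq> {}" and sym: "sym R" and irr: "irrefl R" and RS: "R \<subseteq> S \<times> S"
    and two: "\<And>x. x \<in> S \<Longrightarrow> card (R `` {x}) = 2"
    and conn: "\<And>x y. x \<in> S \<Longrightarrow> y \<in> S \<Longrightarrow> (x, y) \<in> R\<^sup>*"
  obtains xs where "set xs = S" "distinct xs"
    "\<forall>i. Suc i < length xs \<longrightarrow> (xs ! i, xs ! Suc i) \<in> R" "(hd xs, last xs) \<in> R"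
proof -
  define P where "P xs \<longleftrightarrow> xs \<noteq> [] \<and> distinct xs \<and> set xs \<subseteq> S \<and>
      (\<forall>i. Suc i < length xs \<longrightarrow> (xs ! i, xs ! Suc i) \<in> R)" for xs
  have bound: "length xs < Suc (card S)" if "P xs" for xs
    using that fin unfolding P_def by (metis card_mono distinct_card less_Suc_eq_le)
  obtain s where "s \<in> S" using ne by blast
  then have "P [s]" by (simp add: P_def)
  then obtain xs where P: "P xs" and longest: "\<And>ys. P ys \<Longrightarrow> length ys \<le> length xs"
    using ex_has_greatest_nat[of P "[s]" length "Suc (card S)"] bound by (metis less_imp_le)
  have xs: "xs \<noteq> []" "distinct xs" "set xs \<subseteq> S" and step: "\<And>i. Suc i < length xs \<Longrightarrow> (xs ! i, xs ! Suc i) \<in> R"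
    using P by (auto simp: P_def)
  define k where "k = length xs"
  have k0: "k > 0" using xs by (simp add: k_def)
  have inS: "xs ! i \<in> S" if "i < k" for i using that xs by (auto simp: k_def)
  have symD: "(b, a) \<in> R" if "(a, b) \<in> R" for a b using sym that by (rule symD)
  have pred: "(xs ! i, xs ! (i - 1)) \<in> R" if "0 < i" "i < k" for i
    using step[of "i - 1"] that by (auto simp: k_def intro: symD)
  have nbr: "R `` {x} = {a, b}" if "x \<in> S" "(x, a) \<in> R" "(x, b) \<in> R" "a \<noteq> b" for x a b
  proof -
    have "{a, b} \<subseteq> R `` {x}" using that by auto
    moreover have "finite (R `` {x})" using two[OF that(1)] by (metis card.infinite zero_neq_numeral)
    ultimately show ?thesis using two[OF that(1)] that(4) by (metis card_2_iff card_subset_eq)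
  qed
  have last_nbr: "y \<in> set xs" if "(xs ! (k - 1), y) \<in> R" for y
  proof (rule ccontr)
    assume y: "y \<notin> set xs"
    have "i = k - 1" if "Suc i = length xs" for i
      using that by (simp add: k_def)
    then have "P (xs @ [y])"
      unfolding P_def using xs y that step RS
      by (auto simp: nth_append less_Suc_eq)
    then show False using longest by fastforce
  qed
  have neq: "xs ! i \<noteq> xs ! j" if "i < k" "j < k" "i \<noteq> j" for i j
    using that xs by (simp add: nth_eq_iff_index_eq k_def)
  have irrD: "(a, a) \<notin> R" for a using irr by (simp add: irrefl_def)
  have inner: "R `` {xs ! i} = {xs ! (i - 1), xs ! Suc i}" if "0 < i" "Suc i < k" for i
    using that by (intro nbr inS pred step neq) (auto simp: k_def)
  obtain a b where ab: "R `` {xs ! (k - 1)} = {a, b}" "a \<noteq> b"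
    using two[OF inS, of "k - 1"] k0 by (auto simp: card_2_iff)
  have "\<exists>j < k. j \<noteq> k - 2 \<and> (xs ! (k - 1), xs ! j) \<in> R"
  proof -
    have "a \<in> set xs" "b \<in> set xs" using last_nbr ab by auto
    then obtain i j where "i < k" "j < k" "a = xs ! i" "b = xs ! j"
      by (auto simp: in_set_conv_nth k_def)
    moreover have "(xs ! (k - 1), a) \<in> R" "(xs ! (k - 1), b) \<in> R" using ab(1) by auto
    ultimately show ?thesis using ab(2) by (cases "i = k - 2") auto
  qed
  then obtain j where j: "j < k" "j \<noteq> k - 2" "(xs ! (k - 1), xs ! j) \<in> R" by blast
  have "j \<noteq> k - 1" using j irrD by auto
  have "j = 0"
  proof (rule ccontr)
    assume "j \<noteq> 0"
    moreover have "Suc j < k" using j \<open>j \<noteq> k - 1\<close> by linarith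
    ultimately have "xs ! (k - 1) \<in> {xs ! (j - 1), xs ! Suc j}"
      using inner[of j] symD[OF j(3)] by auto
    moreover have "j - 1 \<noteq> k - 1" "j - 1 < k" "Suc j \<noteq> k - 1" using j \<open>Suc j < k\<close> by linarith+
    ultimately show False using neq[of "k - 1" "j - 1"] neq[of "k - 1" "Suc j"] \<open>Suc j < k\<close> by auto
  qed
  then have closing: "(xs ! (k - 1), xs ! 0) \<in> R" using j by simp
  \<comment> \<open>The index \<open>0\<close> differs from \<open>k - 1\<close> and from the
    truncated \<open>k - 2\<close>, which rules out \<open>k = 1\<close> and
    \<open>k = 2\<close>.\<close>
  have k3: "k \<ge> 3" using \<open>j = 0\<close> j \<open>j \<noteq> k - 1\<close> by linarith
  have closed: "b \<in> set xs" if ab: "(a, b) \<in> R" "a \<in> set xs" for a b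
  proof -
    obtain i where i: "i < k" "a = xs ! i" using ab by (auto simp: in_set_conv_nth k_def)
    consider "i = 0" | "i = k - 1" | "0 < i" "Suc i < k" using i by linarith
    then show ?thesis
    proof cases
      case 1
      have "R `` {xs ! 0} = {xs ! 1, xs ! (k - 1)}"
        using k3 step[of 0] by (intro nbr inS symD[OF closing] neq) (auto simp: k_def)
      then have "b \<in> {xs ! 1, xs ! (k - 1)}" using ab i 1 by blast
      then show ?thesis using k3 by (auto simp: k_def)
    next
      case 2
      then show ?thesis using last_nbr ab 2 i by simp
    next
      case 3
      then have "b \<in> {xs ! (i - 1), xs ! Suc i}" using inner[OF 3] ab i by blast
      then show ?thesis using 3 by (auto simp: k_def)
    qed
  qed
  have "S \<subseteq> set xs"
  proof
    fix y assume "y \<in> S"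
    then have "(xs ! 0, y) \<in> R\<^sup>*" using conn inS k0 by blast
    then show "y \<in> set xs" by (rule rtrancl_closed) (use closed xs in auto)
  qed
  then show ?thesis
    using that[of xs] xs step symD[OF closing] by (simp add: hd_conv_nth last_conv_nth k_def)
qed

section \<open>Boundary cycles of faces\<close>

text \<open>
  The boundary of \<open>F\<close> is indexed by all natural numbers with period \<open>p\<close>; \<open>e j\<close> joins \<open>u j\<close> and
  \<open>u (Suc j)\<close>. Rotating the cycle is then a shift of the index.
\<close>

definition boundary_cycle ::
    "'a set \<Rightarrow> 'a set set \<Rightarrow> 'a set \<Rightarrow> nat \<Rightarrow> (nat \<Rightarrow> 'a) \<Rightarrow> (nat \<Rightarrow> 'a set) \<Rightarrow> bool" where
  "boundary_cycle V E F p u e \<longleftrightarrow> p \<ge> 3 \<and> inj_on u {..<p} \<and> u ` {..<p} = V \<inter> F \<and>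
     e ` {..<p} = {f \<in> E. f \<subseteq> F} \<and>
     (\<forall>j. u (j + p) = u j \<and> e (j + p) = e j \<and> e j \<inter> V = {u j, u (Suc j)})"

lemma periodic_mod:
  fixes u :: "nat \<Rightarrow> 'b"
  assumes "\<And>j. u (j + p) = u j"
  shows "u (j mod p) = u j"
proof -
  have "u (i + k * p) = u i" for i k
    by (induction k) (simp_all add: assms add.assoc[symmetric] add.commute[of p] mult.commute)
  from this[of "j mod p" "j div p"] show ?thesis by (simp add: mult.commute)
qed

lemma image_lessThan_mod_shift:
  assumes "p > (0 :: nat)"
  shows "(\<lambda>j. (j + r) mod p) ` {..<p} = {..<p}" and "inj_on (\<lambda>j. (j + r) mod p) {..<p}"
proof -
  show surj: "(\<lambda>j. (j + r) mod p) ` {..<p} = {..<p}"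
  proof (intro equalityI subsetI)
    fix k assume k: "k \<in> {..<p}"
    \<comment> \<open>\<open>p - r mod p\<close> is an additive inverse of \<open>r\<close> modulo
      \<open>p\<close>, which gives the preimage of \<open>k\<close>.\<close>
    have "((k + (p - r mod p)) mod p + r) mod p = (k + (p - r mod p) + r mod p) mod p"
      by (simp add: mod_simps)
    also have "k + (p - r mod p) + r mod p = k + p"
      using mod_less_divisor[OF assms, of r] by linarith
    also have "(k + p) mod p = k" using k by simp
    finally show "k \<in> (\<lambda>j. (j + r) mod p) ` {..<p}" using assms by (intro image_eqI[of _ _ "(k + (p - r mod p)) mod p"]) simp_all
  qed (use assms in auto)
  show "inj_on (\<lambda>j. (j + r) mod p) {..<p}" by (rule eq_card_imp_inj_on) (simp_all add: surj)
qed

text \<open>Rotation moves a chosen edge to position \<open>p - 1\<close>, so that the other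
  \<open>p - 1\<close> edges form a path read in increasing index.\<close>

lemma boundary_cycle_rotate:
  assumes "boundary_cycle V E F p u e"
  shows "boundary_cycle V E F p (\<lambda>j. u (j + r)) (\<lambda>j. e (j + r))"
proof -
  have p: "p \<ge> 3" "inj_on u {..<p}" "u ` {..<p} = V \<inter> F" "e ` {..<p} = {f \<in> E. f \<subseteq> F}"
    and per: "\<And>j. u (j + p) = u j" "\<And>j. e (j + p) = e j" "\<And>j. e j \<inter> V = {u j, u (Suc j)}"
    using assms by (auto simp: boundary_cycle_def)
  have m: "u (j + r) = u ((j + r) mod p)" "e (j + r) = e ((j + r) mod p)" for j
    using per by (simp_all add: periodic_mod)
  have "(\<lambda>j. u (j + r)) ` {..<p} = u ` (\<lambda>j. (j + r) mod p) ` {..<p}"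
    "(\<lambda>j. e (j + r)) ` {..<p} = e ` (\<lambda>j. (j + r) mod p) ` {..<p}"
    by (simp_all add: image_image m[symmetric])
  moreover have "inj_on (u \<circ> (\<lambda>j. (j + r) mod p)) {..<p}"
    using p image_lessThan_mod_shift[of p r] by (intro comp_inj_on) auto
  then have "inj_on (\<lambda>j. u (j + r)) {..<p}" by (simp add: o_def m[symmetric])
  moreover have "u (j + p + r) = u (j + r)" "e (j + p + r) = e (j + r)" for j
    using per(1,2)[of "j + r"] by (simp_all add: ac_simps)
  ultimately show ?thesis
    using p per(3) image_lessThan_mod_shift(1)[of p r] by (simp add: boundary_cycle_def)
qed

text \<open>For \<open>p \<ge> 3\<close> the pairs of consecutive residues modulo \<open>p\<close>
  are pairwise distinct as sets, so the position of an edge can be read off from its ends.\<close>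

lemma boundary_cycle_inj_edges:
  assumes "boundary_cycle V E F p u e"
  shows "inj_on e {..<p}"
proof (rule inj_onI)
  fix i j assume ij: "i \<in> {..<p}" "j \<in> {..<p}" "e i = e j"
  have p: "p \<ge> 3" "inj_on u {..<p}" and per: "\<And>j. u (j + p) = u j" "\<And>j. e j \<inter> V = {u j, u (Suc j)}"
    using assms by (auto simp: boundary_cycle_def)
  have "{u i, u (Suc i)} = {u j, u (Suc j)}" using ij per(2) by metis
  then have "{u (i mod p), u (Suc i mod p)} = {u (j mod p), u (Suc j mod p)}"
    using periodic_mod[of u, OF per(1)] by simp
  then have "u ` {i mod p, Suc i mod p} = u ` {j mod p, Suc j mod p}" by simp
  moreover have "{i mod p, Suc i mod p} \<subseteq> {..<p}" "{j mod p, Suc j mod p} \<subseteq> {..<p}" using p by auto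
  ultimately have "{i mod p, Suc i mod p} = {j mod p, Suc j mod p}"
    using p(2) by (meson inj_on_image_eq_iff)
  then show "i = j" using ij p(1) by (auto simp: doubleton_eq_iff mod_Suc split: if_splits)
qed

section \<open>Trees in a polyhedral incidence structure\<close>

text \<open>
  What is needed of the topology of the dual map. The assumption \<open>vertex_link\<close> says that the
  faces at a vertex \<open>x\<close> form a cycle: they stay connected when crossing the edge \<open>e\<close> is forbidden.
\<close>

locale polyhedral_incidence =
  fixes V :: "'a set" and E FF :: "'a set set"
  assumes finite_verts: "finite V" and finite_edges: "finite E" and finite_faces: "finite FF"
    and card_ends: "e \<in> E \<Longrightarrow> card (e \<inter> V) = 2"
    and edge_eqI: "e \<in> E \<Longrightarrow> f \<in> E \<Longrightarrow> e \<inter> V = f \<inter> V \<Longrightarrow> e = f"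
    and card_sides: "e \<in> E \<Longrightarrow> card {F \<in> FF. e \<subseteq> F} = 2"
    and face_cycle: "F \<in> FF \<Longrightarrow> \<exists>p u e. boundary_cycle V E F p u e"
    and vertex_on_face: "x \<in> V \<Longrightarrow> \<exists>F\<in>FF. x \<in> F"
    and vertex_link: "x \<in> V \<Longrightarrow> e \<in> E \<Longrightarrow> F \<in> FF \<Longrightarrow> x \<in> F \<Longrightarrow> F' \<in> FF \<Longrightarrow> x \<in> F' \<Longrightarrow>
      (F, F') \<in> {(G, G'). G \<in> FF \<and> G' \<in> FF \<and> (\<exists>f\<in>E. f \<noteq> e \<and> x \<in> f \<and> f \<subseteq> G \<and> f \<subseteq> G')}\<^sup>*"
    and face_Int: "F \<in> FF \<Longrightarrow> F' \<in> FF \<Longrightarrow> F \<noteq> F' \<Longrightarrow> e \<in> E \<Longrightarrow> e \<subseteq> F \<Longrightarrow> e \<subseteq> F' \<Longrightarrow> F \<inter> F' = e"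

text \<open>Conditions (2) and (3) of a proper tree, which concern one face at a time. The degree
  sum of condition (1) enters later, in \<open>all_faces_touched\<close>.\<close>

locale tree_in_faces = polyhedral_incidence V E FF
  for V :: "'a set" and E FF :: "'a set set" +
  fixes W :: "'a set" and A :: "'a set set"
  assumes subgraph: "subgraph_of W A V E" and tree: "tree_graph W A"
    and joined: "F \<in> FF \<Longrightarrow> u1 \<in> W \<inter> F \<Longrightarrow> u2 \<in> W \<inter> F \<Longrightarrow>
      \<exists>xs. hd xs = u1 \<and> last xs = u2 \<and>
        path_in (boundary_verts V F) (boundary_edges E F) xs \<and> path_in W A xs"
    and short: "F \<in> FF \<Longrightarrow> path_in W A xs \<Longrightarrow>
      path_in (boundary_verts V F) (boundary_edges E F) xs \<Longrightarrow>
      int (path_length xs) \<le> int (card (boundary_edges E F)) - 2"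
begin

lemma W_subset_V: "W \<subseteq> V" and A_subset_E: "A \<subseteq> E" and ends_A: "e \<in> A \<Longrightarrow> e \<inter> V \<subseteq> W"
  using subgraph by (auto simp: subgraph_of_def)

text \<open>Reconciles two readings of the ends of an edge: \<open>e \<inter> W\<close> inside the
  tree, \<open>e \<inter> V\<close> in the whole graph.\<close>

lemma A_ends_eq: "e \<in> A \<Longrightarrow> e \<inter> W = e \<inter> V"
  using W_subset_V ends_A by blast

text \<open>Each step of the list from \<open>joined\<close> is made by a tree edge and by a
  boundary edge of \<open>F\<close>; both have the same ends, so simplicity of the graph makes them
  one edge.\<close>

lemma joined_in_face:
  assumes "F \<in> FF" "u1 \<in> W \<inter> F" "u2 \<in> W \<inter> F"
  shows "(u1, u2) \<in> {(x, y). \<exists>f\<in>A. f \<subseteq> F \<and> f \<inter> V = {x, y}}\<^sup>*"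
proof -
  obtain xs where xs: "hd xs = u1" "last xs = u2"
    "path_in (boundary_verts V F) (boundary_edges E F) xs" "path_in W A xs"
    using joined[OF assms] by blast
  have "(hd xs, last xs) \<in> {(x, y). \<exists>f\<in>A. f \<subseteq> F \<and> f \<inter> V = {x, y}}\<^sup>*"
  proof (rule rtrancl_of_chain)
    show "xs \<noteq> []" using xs by (simp add: path_in_def)
    fix i assume i: "Suc i < length xs"
    then obtain f where f: "f \<in> A" "f \<inter> W = {xs ! i, xs ! Suc i}"
      using xs(4) by (auto simp: path_in_def adjacent_in_def)
    from i obtain g where g: "g \<in> E" "g \<subseteq> F" "g \<inter> (V \<inter> F) = {xs ! i, xs ! Suc i}"
      using xs(3) by (auto simp: path_in_def adjacent_in_def boundary_verts_def boundary_edges_def)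
    have "g \<inter> V = f \<inter> V" using f g A_ends_eq by (metis inf.absorb_iff2 inf_assoc inf_commute)
    then have "g = f" using edge_eqI f g A_subset_E by blast
    then show "(xs ! i, xs ! Suc i) \<in> {(x, y). \<exists>f\<in>A. f \<subseteq> F \<and> f \<inter> V = {x, y}}"
      using f g A_ends_eq by auto
  qed
  then show ?thesis using xs by simp
qed

text \<open>Otherwise \<open>u 0, ..., u (p - 1)\<close> would be a tree path of length
  \<open>p - 1\<close> in \<open>F\<close>, exceeding the bound \<open>p - 2\<close>. Applied to all
  rotations, this says that at least two boundary edges are missing from the tree.\<close>

lemma no_almost_full_face:
  assumes F: "F \<in> FF" and c: "boundary_cycle V E F p u e"
  shows "\<exists>j<p - 1. e j \<notin> A"
proof (rule ccontr)
  assume "\<not> ?thesis"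
  then have eA: "\<And>j. j < p - 1 \<Longrightarrow> e j \<in> A" by blast
  have p: "p \<ge> 3" "inj_on u {..<p}" "u ` {..<p} = V \<inter> F" "e ` {..<p} = {f \<in> E. f \<subseteq> F}"
    and per: "\<And>j. u (j + p) = u j" "\<And>j. e (j + p) = e j" "\<And>j. e j \<inter> V = {u j, u (Suc j)}"
    using c by (auto simp: boundary_cycle_def)
  define xs where "xs = map u [0..<p]"
  have uW: "u j \<in> W" if "j < p" for j
  proof (cases "j < p - 1")
    case True
    then show ?thesis using ends_A[OF eA[OF True]] per(3)[of j] by auto
  next
    case False
    then have "j = Suc (p - 2)" "p - 2 < p - 1" using that p(1) by linarith+
    then show ?thesis using ends_A[OF eA, of "p - 2"] per(3)[of "p - 2"] by auto
  qed
  have inj: "u i \<noteq> u (Suc i)" if "Suc i < p" for i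
    using inj_onD[OF p(2), of i "Suc i"] that by auto
  have dist: "distinct xs" "xs \<noteq> []" "set xs = u ` {..<p}"
    using p(1,2) by (auto simp: xs_def distinct_map atLeast0LessThan)
  have step: "\<exists>f\<in>A. f \<subseteq> F \<and> f \<inter> V = {xs ! i, xs ! Suc i}" if "Suc i < length xs" for i
  proof (rule bexI)
    have i: "Suc i < p" using that by (simp add: xs_def)
    then show "e i \<in> A" by (intro eA) linarith
    have "e i \<in> {f \<in> E. f \<subseteq> F}" unfolding p(4)[symmetric] using i by simp
    then show "e i \<subseteq> F \<and> e i \<inter> V = {xs ! i, xs ! Suc i}" using i per(3) by (simp add: xs_def)
  qed
  have neq: "xs ! i \<noteq> xs ! Suc i" if "Suc i < length xs" for i
    using dist(1) that by (simp add: nth_eq_iff_index_eq)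
  have "path_in W A xs"
    unfolding path_in_def adjacent_in_def
  proof (intro conjI allI impI)
    show "xs \<noteq> []" "distinct xs" "set xs \<subseteq> W" using dist uW by auto
    fix i assume i: "Suc i < length xs"
    show "xs ! i \<noteq> xs ! Suc i" by (rule neq[OF i])
    show "\<exists>f\<in>A. f \<inter> W = {xs ! i, xs ! Suc i}" using step[OF i] A_ends_eq by metis
  qed
  moreover have "path_in (boundary_verts V F) (boundary_edges E F) xs"
    unfolding path_in_def adjacent_in_def boundary_verts_def boundary_edges_def
  proof (intro conjI allI impI)
    show "xs \<noteq> []" "distinct xs" "set xs \<subseteq> V \<inter> F" using dist p(3) by auto
    fix i assume i: "Suc i < length xs"
    show "xs ! i \<noteq> xs ! Suc i" by (rule neq[OF i])
    obtain f where "f \<in> A" "f \<subseteq> F" "f \<inter> V = {xs ! i, xs ! Suc i}" using step[OF i] by blast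
    then show "\<exists>e\<in>{e \<in> E. e \<subseteq> F}. e \<inter> (V \<inter> F) = {xs ! i, xs ! Suc i}"
      using A_subset_E by (intro bexI[of _ f]) auto
  qed
  ultimately have "int (path_length xs) \<le> int (card (boundary_edges E F)) - 2" by (rule short[OF F])
  moreover have "card (boundary_edges E F) = p"
    by (simp add: boundary_edges_def p(4)[symmetric] card_image[OF boundary_cycle_inj_edges[OF c]])
  ultimately show False using p(1) by (simp add: path_length_def xs_def)
qed

text \<open>The index is rotated to a place where the boundary enters \<open>W\<close>. A gap before
  the last tree vertex would, together with the missing edge \<open>e (p - 1)\<close>, separate two
  tree vertices that condition (2) joins along the boundary, so the tree fills one initial
  arc.\<close>

lemma face_arc:
  assumes F: "F \<in> FF" and touch: "W \<inter> F \<noteq> {}"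
  obtains p u e m where "boundary_cycle V E F p u e" "m < p - 1"
    "\<And>j. j < p \<Longrightarrow> u j \<in> W \<longleftrightarrow> j \<le> m" "\<And>j. j < p \<Longrightarrow> e j \<in> A \<longleftrightarrow> j < m"
proof -
  let ?R = "{(x, y). \<exists>f\<in>A. f \<subseteq> F \<and> f \<inter> V = {x, y}}"
  \<comment> \<open>Two edges outside \<open>A\<close> split the boundary into two arcs, and \<open>W\<close> cannot meet both.\<close>
  have separated: False
    if c: "boundary_cycle V E F p u e" and "e (p - 1) \<notin> A" "e j \<notin> A" "j < p - 1"
      "i \<le> j" "j < k" "k < p" "u i \<in> W" "u k \<in> W" for p u e i j k
  proof -
    have p: "p \<ge> 3" "inj_on u {..<p}" "u ` {..<p} = V \<inter> F" "e ` {..<p} = {f \<in> E. f \<subseteq> F}"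
      and per: "\<And>j. u (j + p) = u j" "\<And>j. e (j + p) = e j" "\<And>j. e j \<inter> V = {u j, u (Suc j)}"
      using c by (auto simp: boundary_cycle_def)
    have eq: "u a = u b \<longleftrightarrow> a = b" if "a < p" "b < p" for a b
      using inj_onD[OF p(2)] that by auto
    have "(u i, u k) \<in> ?R\<^sup>*"
      using p(3) that by (intro joined_in_face[OF F]) auto
    then have "u k \<in> u ` {..j}"
    proof (rule rtrancl_closed)
      show "u i \<in> u ` {..j}" using that by auto
      \<comment> \<open>The only boundary edges leaving \<open>u 0, ..., u j\<close> are
        \<open>e j\<close> and \<open>e (p - 1)\<close>, neither of them in
        \<open>A\<close>.\<close>
      fix x y assume "(x, y) \<in> ?R" "x \<in> u ` {..j}"
      then obtain f a where f: "f \<in> A" "f \<subseteq> F" "f \<inter> V = {x, y}" and a: "x = u a" "a \<le> j" by (elim CollectE case_prodE bexE conjE imageE) (auto simp: prod_eq_iff)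
      have "f \<in> e ` {..<p}" unfolding p(4) using f A_subset_E by auto
      then obtain l where l: "l < p" "f = e l" by auto
      then have "l \<noteq> p - 1" "l \<noteq> j" using f that by auto
      then have l': "Suc l < p" using l by linarith
      have "{u l, u (Suc l)} = {u a, y}" using f a l per(3) by metis
      moreover have "a < p" using a \<open>j < p - 1\<close> by linarith
      ultimately have "a = l \<and> y = u (Suc l) \<or> a = Suc l \<and> y = u l"
        using eq[of a l] eq[of a "Suc l"] l(1) l' unfolding doubleton_eq_iff by metis
      then show "y \<in> u ` {..j}" using a \<open>l \<noteq> j\<close> by auto
    qed
    then obtain a where "u k = u a" "a \<le> j" by auto
    then show False using eq[of k a] that by auto
  qed
  obtain p u e where c: "boundary_cycle V E F p u e" using face_cycle[OF F] by blast
  have p: "p \<ge> 3" and uF: "u ` {..<p} = V \<inter> F" and per: "\<And>j. u (j + p) = u j"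
    using c by (auto simp: boundary_cycle_def)
  \<comment> \<open>If all boundary vertices were in \<open>W\<close>, the two missing edges found
    by \<open>no_almost_full_face\<close> for two rotations would separate some of them.\<close>
  have "\<exists>r. u r \<notin> W"
  proof (rule ccontr)
    assume "\<nexists>r. u r \<notin> W"
    then have all: "\<And>r. u r \<in> W" by blast
    obtain j where j: "e j \<notin> A" using no_almost_full_face[OF F c] by blast
    define u' e' where "u' i = u (i + Suc j)" and "e' i = e (i + Suc j)" for i
    have c': "boundary_cycle V E F p u' e'"
      unfolding u'_def e'_def by (rule boundary_cycle_rotate[OF c])
    have "e' (p - 1) = e j"
      using c p by (auto simp: e'_def boundary_cycle_def add.commute[of _ j])
    moreover obtain k where "k < p - 1" "e' k \<notin> A" using no_almost_full_face[OF F c'] by blast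
    ultimately show False
      using separated[OF c', of k k "p - 1"] j all p by (auto simp: u'_def)
  qed
  then obtain r where r: "u r \<notin> W" by blast
  have "u ` {..<p} \<inter> W \<noteq> {}" using touch uF W_subset_V by blast
  then obtain s0 where s0: "u s0 \<in> W" "s0 < p" by auto
  have "\<exists>s. u s \<notin> W \<and> u (Suc s) \<in> W"
  proof (rule ccontr)
    assume a: "\<not> ?thesis"
    have outside: "u (r + k) \<notin> W" for k
      by (induction k) (use r a in auto)
    \<comment> \<open>A copy of \<open>s0\<close> shifted by \<open>r\<close> periods lies at or
      beyond \<open>r\<close>, where all vertices would be outside \<open>W\<close>.\<close>
    have "u (s0 + r * p) = u s0"
      using periodic_mod[of u p "s0 + r * p", OF per] s0(2) by simp
    moreover have "r * 1 \<le> r * p" using p by (intro mult_le_mono) auto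
    then have "s0 + r * p = r + (s0 + r * p - r)" by linarith
    ultimately show False using s0(1) outside[of "s0 + r * p - r"] by simp
  qed
  then obtain s where s: "u s \<notin> W" "u (Suc s) \<in> W" by blast
  \<comment> \<open>The tree vertex \<open>u (Suc s)\<close> becomes \<open>u' 0\<close> and the
    outer vertex \<open>u s\<close> becomes \<open>u' (p - 1)\<close>.\<close>
  define u' e' where "u' i = u (i + Suc s)" and "e' i = e (i + Suc s)" for i
  have c': "boundary_cycle V E F p u' e'"
    unfolding u'_def e'_def by (rule boundary_cycle_rotate[OF c])
  then have eu: "\<And>j. e' j \<inter> V = {u' j, u' (Suc j)}" by (auto simp: boundary_cycle_def)
  have u'0: "u' 0 \<in> W" using s by (simp add: u'_def)
  have "u' (p - 1) = u s" using per[of s] p by (simp add: u'_def add.commute)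
  then have u'p: "u' (p - 1) \<notin> W" using s by simp
  then have e'p: "e' (p - 1) \<notin> A" using ends_A[of "e' (p - 1)"] eu[of "p - 1"] by auto
  define m where "m = Max {j. j < p \<and> u' j \<in> W}"
  have fin: "finite {j. j < p \<and> u' j \<in> W}" by simp
  have "0 \<in> {j. j < p \<and> u' j \<in> W}" using u'0 p by simp
  then have "m \<in> {j. j < p \<and> u' j \<in> W}" unfolding m_def using Max_in[OF fin] by blast
  then have m: "m < p" "u' m \<in> W" by auto
  have m_max: "j \<le> m" if "j < p" "u' j \<in> W" for j using Max_ge[OF fin] that by (simp add: m_def)
  have "m \<noteq> p - 1" using m u'p by auto
  then have mp: "m < p - 1" using m by linarith
  have eA: "e' j \<in> A" if "j < m" for j
  proof (rule ccontr)
    assume "e' j \<notin> A"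
    then show False using separated[OF c' e'p, of j 0 m] that m mp u'0 by auto
  qed
  have uW: "u' j \<in> W" if "j \<le> m" for j
    using eA[of "j - 1"] ends_A[of "e' (j - 1)"] eu[of "j - 1"] that u'0 by (cases j) auto
  have "j < m" if "j < p" "e' j \<in> A" for j
  proof -
    have "u' (Suc j) \<in> W" using ends_A[OF that(2)] eu[of j] by simp
    moreover have "j \<noteq> p - 1" using that e'p by auto
    ultimately show ?thesis using m_max[of "Suc j"] that(1) by linarith
  qed
  then show ?thesis using uW eA m_max by (intro that[OF c' mp] iffI) auto
qed

end

section \<open>Edge cuts and adjacency of faces\<close>

context polyhedral_incidence
begin

definition cut :: "'a set \<Rightarrow> 'a set set" where
  "cut S = {e \<in> E. e \<inter> S \<noteq> {} \<and> \<not> e \<inter> V \<subseteq> S}"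

text \<open>The dual graph restricted to the edges in \<open>D\<close>. A face with such an edge is
  also related to itself, which is harmless because \<open>link\<close> is used through its
  reflexive transitive closure.\<close>

definition link :: "'a set set \<Rightarrow> 'a set rel" where
  "link D = {(F, F'). F \<in> FF \<and> F' \<in> FF \<and> (\<exists>f\<in>D. f \<subseteq> F \<and> f \<subseteq> F')}"

lemma edge_on_face: "e \<in> E \<Longrightarrow> \<exists>F\<in>FF. e \<subseteq> F"
  using card_sides[of e] by (metis (mono_tags, lifting) Collect_empty_eq card.empty zero_neq_numeral)

lemma ends_of:
  assumes "e \<in> E" "x \<in> e" "x \<in> V"
  obtains y where "e \<inter> V = {x, y}" "x \<noteq> y"
proof -
  obtain a b where "e \<inter> V = {a, b}" "a \<noteq> b" using card_ends[OF assms(1)] by (auto simp: card_2_iff)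
  moreover have "x \<in> e \<inter> V" using assms by simp
  ultimately show ?thesis using that by auto
qed

end

context tree_in_faces
begin

text \<open>The edge lies on some face, where its ends are neighbours on the tree arc
  \<open>u 0, ..., u m\<close>; the edges between such neighbours are the \<open>g j\<close> with
  \<open>j < m\<close>, and those are in the tree.\<close>

lemma induced:
  assumes "e \<in> E" "e \<inter> V \<subseteq> W"
  shows "e \<in> A"
proof -
  obtain F where F: "F \<in> FF" "e \<subseteq> F" using edge_on_face assms by blast
  have "e \<inter> V \<noteq> {}" using card_ends[OF assms(1)] by auto
  then have "W \<inter> F \<noteq> {}" using assms F by blast
  from face_arc[OF F(1) this] obtain p u g m where
    c: "boundary_cycle V E F p u g" and m: "m < p - 1"
    and uW: "\<And>j. j < p \<Longrightarrow> u j \<in> W \<longleftrightarrow> j \<le> m" and gA: "\<And>j. j < p \<Longrightarrow> g j \<in> A \<longleftrightarrow> j < m" by metis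
  have "e \<in> g ` {..<p}" using c assms(1) F by (auto simp: boundary_cycle_def)
  then obtain j where j: "j < p" "e = g j" by auto
  have "{u j, u (Suc j)} \<subseteq> W" using assms(2) j c by (auto simp: boundary_cycle_def)
  then have "j \<le> m" "u (Suc j) \<in> W" using uW[OF j(1)] by auto
  moreover have "Suc m < p" using m by linarith
  ultimately have "j < m" using uW[of "Suc j"] by (cases "j = m") auto
  then show ?thesis using gA j by simp
qed

text \<open>The boundary passes between the tree arc and its complement exactly twice, at
  \<open>g m\<close> and at the closing edge \<open>g (p - 1)\<close>.\<close>

lemma card_cut_face:
  assumes "F \<in> FF" "W \<inter> F \<noteq> {}"
  shows "card {f \<in> cut W. f \<subseteq> F} = 2"
proof -
  from face_arc[OF assms] obtain p u g m where
    c: "boundary_cycle V E F p u g" and m: "m < p - 1"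
    and uW: "\<And>j. j < p \<Longrightarrow> u j \<in> W \<longleftrightarrow> j \<le> m" by metis
  have p: "p \<ge> 3" "g ` {..<p} = {f \<in> E. f \<subseteq> F}" "u p = u 0" and gu: "\<And>j. g j \<inter> V = {u j, u (Suc j)}"
    using c by (auto simp: boundary_cycle_def) (metis add_0)
  have gE: "g j \<in> E" "g j \<subseteq> F" if "j < p" for j
  proof -
    have "g j \<in> {f \<in> E. f \<subseteq> F}" unfolding p(2)[symmetric] using that by simp
    then show "g j \<in> E" "g j \<subseteq> F" by auto
  qed
  have "g j \<inter> W = {u j, u (Suc j)} \<inter> W" for j using gu[of j] W_subset_V by blast
  then have cut_iff: "g j \<in> cut W \<longleftrightarrow> (u j \<in> W) \<noteq> (u (Suc j) \<in> W)" if "j < p" for j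
    using gu[of j] gE[OF that] by (auto simp: cut_def)
  have "g j \<in> cut W \<longleftrightarrow> j = m \<or> j = p - 1" if "j < p" for j
  proof (cases "j = p - 1")
    case True
    then have "Suc j = p" using that by simp
    then show ?thesis using cut_iff[OF that] uW[of j] uW[of 0] p m True that by auto
  next
    case False
    then have "Suc j < p" using that by linarith
    then show ?thesis using cut_iff[OF that] uW[of j] uW[of "Suc j"] False that by auto
  qed
  then have "{j \<in> {..<p}. g j \<in> cut W} = {m, p - 1}" using m by auto
  moreover have "{f \<in> cut W. f \<subseteq> F} = {f \<in> g ` {..<p}. f \<in> cut W}"
    unfolding p(2) by (auto simp: cut_def)
  then have "{f \<in> cut W. f \<subseteq> F} = g ` {j \<in> {..<p}. g j \<in> cut W}" by auto
  ultimately have "{f \<in> cut W. f \<subseteq> F} = g ` {m, p - 1}" by simp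
  moreover have "inj_on g {m, p - 1}"
    using boundary_cycle_inj_edges[OF c] by (rule inj_on_subset) (use m in auto)
  ultimately show ?thesis using m by (simp add: card_image)
qed

text \<open>The boundary vertices outside the tree are \<open>u (m + 1), ..., u (p - 1)\<close>, and
  the edges between consecutive ones avoid \<open>W\<close>, hence are not cut.\<close>

lemma outer_joined:
  assumes "F \<in> FF" "W \<inter> F \<noteq> {}" "x \<in> F \<inter> (V - W)" "y \<in> F \<inter> (V - W)"
  shows "(x, y) \<in> {(x, y). adjacent_in V (E - cut W) x y}\<^sup>*" (is "_ \<in> ?R\<^sup>*")
proof -
  from face_arc[OF assms(1,2)] obtain p u g m where
    c: "boundary_cycle V E F p u g" and m: "m < p - 1"
    and uW: "\<And>j. j < p \<Longrightarrow> u j \<in> W \<longleftrightarrow> j \<le> m" by metis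
  have p: "p \<ge> 3" "inj_on u {..<p}" "u ` {..<p} = V \<inter> F" "g ` {..<p} = {f \<in> E. f \<subseteq> F}"
    and gu: "\<And>j. g j \<inter> V = {u j, u (Suc j)}"
    using c by (auto simp: boundary_cycle_def)
  have step: "(u j, u (Suc j)) \<in> ?R" if "m < j" "Suc j < p" for j
  proof -
    have "u j \<notin> W" "u (Suc j) \<notin> W" using uW[of j] uW[of "Suc j"] that by auto
    moreover have "g j \<inter> W \<subseteq> {u j, u (Suc j)}" using gu[of j] W_subset_V by blast
    ultimately have "g j \<notin> cut W" by (auto simp: cut_def)
    moreover have "g j \<in> {f \<in> E. f \<subseteq> F}" unfolding p(4)[symmetric] using that by simp
    moreover have "u j \<noteq> u (Suc j)" using inj_onD[OF p(2), of j "Suc j"] that by auto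
    ultimately show ?thesis using gu[of j] by (auto simp: adjacent_in_def)
  qed
  have "sym ?R" by (auto simp: sym_def adjacent_in_def insert_commute)
  then have sym: "sym (?R\<^sup>*)" by (rule sym_rtrancl)
  have up: "(u i, u j) \<in> ?R\<^sup>*" if "i \<le> j" "m < i" "j < p" for i j
    using that
  proof (induction j rule: dec_induct)
    case (step n)
    then have "(u i, u n) \<in> ?R\<^sup>*" "(u n, u (Suc n)) \<in> ?R" using \<open>\<And>j. \<lbrakk>m < j; Suc j < p\<rbrakk> \<Longrightarrow> (u j, u (Suc j)) \<in> ?R\<close> by auto
    then show ?case by (rule rtrancl_into_rtrancl)
  qed simp
  have "x \<in> u ` {..<p}" "y \<in> u ` {..<p}" using assms p(3) by auto
  then obtain i j where ij: "x = u i" "y = u j" "i < p" "j < p" by auto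
  then have "m < i" "m < j" using assms uW by (metis DiffD2 IntD2 not_le)+
  then show ?thesis using up[of i j] up[of j i] symD[OF sym] ij by (cases "i \<le> j") auto
qed

text \<open>Induction invariant for subtrees on \<open>S\<close>. Connectedness inside
  \<open>S\<close> makes a second tree edge from a new vertex into \<open>S\<close> close a cycle;
  the edge count and the linking of faces are the facts wanted for \<open>S = W\<close>.\<close>

definition grown :: "'a set \<Rightarrow> bool" where
  "grown S \<longleftrightarrow> S \<subseteq> W \<and> S \<noteq> {} \<and>
     (\<forall>x\<in>S. \<forall>y\<in>S. (x, y) \<in> {(x, y). x \<in> S \<and> y \<in> S \<and> adjacent_in W A x y}\<^sup>*) \<and>
     card {e \<in> A. e \<inter> V \<subseteq> S} + 1 = card S \<and>
     (\<forall>F\<in>FF. \<forall>F'\<in>FF. F \<inter> S \<noteq> {} \<longrightarrow> F' \<inter> S \<noteq> {} \<longrightarrow> (F, F') \<in> (link (cut S))\<^sup>*)"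

text \<open>Every edge at \<open>w\<close> is cut by \<open>{w}\<close>, so the linking of the faces
  at \<open>w\<close> comes from \<open>vertex_link\<close>.\<close>

lemma grown_singleton:
  assumes "w \<in> W"
  shows "grown {w}"
proof -
  have none: "{e \<in> A. e \<inter> V \<subseteq> {w}} = {}"
  proof (rule ccontr)
    assume "\<not> ?thesis"
    then obtain e where "e \<in> A" "e \<inter> V \<subseteq> {w}" by blast
    then show False using card_ends[of e] A_subset_E card_mono[of "{w}" "e \<inter> V"] by auto
  qed
  have "(F, F') \<in> (link (cut {w}))\<^sup>*" if "F \<in> FF" "F' \<in> FF" "w \<in> F" "w \<in> F'" for F F'
  proof (cases "\<exists>e. e \<in> E")
    \<comment> \<open>Impossible, since the face \<open>F\<close> has boundary edges. An edge is
      wanted because \<open>vertex_link\<close> takes one to be avoided.\<close>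
    case False
    moreover obtain p u e where "boundary_cycle V E F p u e" using face_cycle[OF \<open>F \<in> FF\<close>] by blast
    then have "e ` {..<p} \<subseteq> E" "0 \<in> {..<p}" by (auto simp: boundary_cycle_def)
    then have "e 0 \<in> E" by blast
    ultimately show ?thesis by blast
  next
    case True
    then obtain e where "e \<in> E" by blast
    have "{(G, G'). G \<in> FF \<and> G' \<in> FF \<and> (\<exists>f\<in>E. f \<noteq> e \<and> w \<in> f \<and> f \<subseteq> G \<and> f \<subseteq> G')} \<subseteq> link (cut {w})"
    proof -
      have "f \<in> cut {w}" if "f \<in> E" "w \<in> f" for f
      proof -
        have "w \<in> V" using assms W_subset_V by blast
        from ends_of[OF that this] obtain y where "f \<inter> V = {w, y}" "w \<noteq> y" by metis
        then show ?thesis using that by (auto simp: cut_def)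
      qed
      then show ?thesis by (auto simp: link_def)
    qed
    then show ?thesis
      using vertex_link[of w e F F'] assms W_subset_V that \<open>e \<in> E\<close> rtrancl_mono by blast
  qed
  then show ?thesis using assms unfolding grown_def none by auto
qed

text \<open>Along a tree path from \<open>S\<close> to a vertex outside, some edge \<open>e\<close>
  leaves \<open>S\<close>, from \<open>s\<close> to a new vertex \<open>v\<close>. Absence of cycles
  and \<open>induced\<close> make \<open>e\<close> the only edge of the graph between
  \<open>v\<close> and \<open>S\<close>, so \<open>v\<close> is added as a leaf.\<close>

lemma grow:
  assumes S: "grown S" and "S \<noteq> W"
  shows "\<exists>v. v \<in> W - S \<and> grown (insert v S)"
proof -
  let ?R = "\<lambda>S. {(x, y). x \<in> S \<and> y \<in> S \<and> adjacent_in W A x y}"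
  have SW: "S \<subseteq> W" "S \<noteq> {}" and conn: "\<And>x y. x \<in> S \<Longrightarrow> y \<in> S \<Longrightarrow> (x, y) \<in> (?R S)\<^sup>*"
    and count: "card {e \<in> A. e \<inter> V \<subseteq> S} + 1 = card S"
    and linked: "\<And>F F'. \<lbrakk>F \<in> FF; F' \<in> FF; F \<inter> S \<noteq> {}; F' \<inter> S \<noteq> {}\<rbrakk> \<Longrightarrow> (F, F') \<in> (link (cut S))\<^sup>*"
    using S unfolding grown_def by auto
  obtain s0 w where s0: "s0 \<in> S" and w: "w \<in> W" "w \<notin> S" using SW assms(2) by blast
  have "\<exists>xs. path_in W A xs \<and> hd xs = s0 \<and> last xs = w"
    using tree s0 w SW unfolding tree_graph_def connected_graph_def by blast
  then have path: "(s0, w) \<in> {(x, y). adjacent_in W A x y}\<^sup>*"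
    using path_in_joins_iff[of s0 W A w] s0 SW(1) by auto
  have "\<exists>s v. s \<in> S \<and> v \<notin> S \<and> adjacent_in W A s v"
  proof (rule ccontr)
    assume "\<not> ?thesis"
    then have "w \<in> S" by (intro rtrancl_closed[OF path s0]) auto
    then show False using w by simp
  qed
  then obtain s v e where s: "s \<in> S" and vS: "v \<notin> S" and adj: "adjacent_in W A s v"
    and e: "e \<in> A" "e \<inter> W = {s, v}" by (auto simp: adjacent_in_def)
  have v: "v \<in> W" "v \<in> V" using e W_subset_V by auto
  have eV: "e \<inter> V = {s, v}" using A_ends_eq[OF e(1)] e(2) by simp
  have adj_sym: "adjacent_in W A y x" if "adjacent_in W A x y" for x y
    using that by (auto simp: adjacent_in_def insert_commute)
  \<comment> \<open>A second neighbour \<open>s'\<close> would close a cycle through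
    \<open>v\<close> and a path inside \<open>S\<close> from \<open>s\<close> to
    \<open>s'\<close>.\<close>
  have leaf: "s' = s" if s': "s' \<in> S" "adjacent_in W A s' v" for s'
  proof (rule ccontr)
    assume "s' \<noteq> s"
    obtain xs where xs: "xs \<noteq> []" "distinct xs" "hd xs = s" "last xs = s'"
      and step: "\<forall>i. Suc i < length xs \<longrightarrow> (xs ! i, xs ! Suc i) \<in> ?R S"
      by (rule distinct_chain_of_rtrancl[OF conn[OF s s'(1)]])
    have len: "length xs \<ge> 2"
      using xs \<open>s' \<noteq> s\<close> by (cases xs; cases "tl xs") auto
    have inS: "xs ! i \<in> S" if "i < length xs" for i
      using step[rule_format, of 0] step[rule_format, of "i - 1"] that len by (cases i) auto
    then have "set xs \<subseteq> S" by (auto simp: in_set_conv_nth)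
    have "path_in W A (xs @ [v])"
      unfolding path_in_def
    proof (intro conjI allI impI)
      show "xs @ [v] \<noteq> []" by simp
      show "distinct (xs @ [v])" using xs vS \<open>set xs \<subseteq> S\<close> by auto
      show "set (xs @ [v]) \<subseteq> W" using v SW \<open>set xs \<subseteq> S\<close> by auto
      fix i assume i: "Suc i < length (xs @ [v])"
      show "adjacent_in W A ((xs @ [v]) ! i) ((xs @ [v]) ! Suc i)"
      proof (cases "Suc i < length xs")
        case True then show ?thesis using step True by (simp add: nth_append)
      next
        case False
        then have "Suc i = length xs" using i by simp
        then have "xs ! i = s'" using xs(1,4) by (metis diff_Suc_1 last_conv_nth)
        then show ?thesis using s'(2) \<open>Suc i = length xs\<close> by (simp add: nth_append)
      qed
    qed
    then have "cycle_in W A (xs @ [v])"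
      using xs len adj_sym[OF adj] by (simp add: cycle_in_def)
    then show False using tree by (auto simp: tree_graph_def)
  qed
  have only_e: "f = e" if f: "f \<in> E" "v \<in> f" "f \<inter> S \<noteq> {}" for f
  proof -
    obtain y where y: "f \<inter> V = {v, y}" "v \<noteq> y" using ends_of[OF f(1,2) v(2)] by blast
    then have "y \<in> S" using f(3) vS SW W_subset_V by auto
    then have "f \<in> A" using induced[OF f(1)] y v SW by auto
    then have "f \<inter> W = {y, v}" using A_ends_eq[of f] y by (simp add: insert_commute)
    then have "y = s" using leaf[OF \<open>y \<in> S\<close>] y(2) \<open>f \<in> A\<close> by (auto simp: adjacent_in_def)
    then show ?thesis using edge_eqI[of f e] y eV f e A_subset_E by (auto simp: insert_commute)
  qed
  have only_e': "f = e" if f: "f \<in> E" "v \<in> f" "f \<inter> V \<subseteq> insert v S" for f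
  proof (rule only_e[OF f(1,2)])
    obtain y where "f \<inter> V = {v, y}" "v \<noteq> y" using ends_of[OF f(1,2) v(2)] by blast
    then show "f \<inter> S \<noteq> {}" using f(3) by auto
  qed
  let ?T = "insert v S"
  have connT: "(x, y) \<in> (?R ?T)\<^sup>*" if "x \<in> ?T" "y \<in> ?T" for x y
  proof -
    have "?R S \<subseteq> ?R ?T" by auto
    then have old: "(x, y) \<in> (?R ?T)\<^sup>*" if "x \<in> S" "y \<in> S" for x y
      using conn[OF that] rtrancl_mono by blast
    have sv: "(s, v) \<in> ?R ?T" "(v, s) \<in> ?R ?T" using s adj adj_sym by auto
    have "(x, s) \<in> (?R ?T)\<^sup>*" using that(1) old s sv(2) by auto
    moreover have "(s, y) \<in> (?R ?T)\<^sup>*" using that(2) old s sv(1) by auto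
    ultimately show ?thesis by (rule rtrancl_trans)
  qed
  have "finite S" using SW W_subset_V finite_verts by (meson finite_subset)
  have finA: "finite A" using A_subset_E finite_edges finite_subset by blast
  have "{f \<in> A. f \<inter> V \<subseteq> ?T} = insert e {f \<in> A. f \<inter> V \<subseteq> S}"
  proof (intro equalityI subsetI)
    fix f assume f: "f \<in> {f \<in> A. f \<inter> V \<subseteq> ?T}"
    show "f \<in> insert e {f \<in> A. f \<inter> V \<subseteq> S}"
    proof (cases "v \<in> f")
      case True then show ?thesis using only_e'[of f] f A_subset_E by auto
    next
      case False then show ?thesis using f by auto
    qed
  qed (use e eV s in auto)
  moreover have "e \<notin> {f \<in> A. f \<inter> V \<subseteq> S}" using eV vS by auto
  ultimately have countT: "card {f \<in> A. f \<inter> V \<subseteq> ?T} + 1 = card ?T"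
    using count \<open>finite S\<close> vS finA by simp
  let ?L = "link (cut ?T)"
  \<comment> \<open>The edge \<open>e\<close> is no longer cut, but its two sides are linked the other way round \<open>v\<close>.\<close>
  have around: "(G, G') \<in> ?L\<^sup>*" if "G \<in> FF" "G' \<in> FF" "v \<in> G" "v \<in> G'" for G G'
  proof -
    have "{(G, G'). G \<in> FF \<and> G' \<in> FF \<and> (\<exists>f\<in>E. f \<noteq> e \<and> v \<in> f \<and> f \<subseteq> G \<and> f \<subseteq> G')} \<subseteq> ?L"
    proof -
      have "f \<in> cut ?T" if "f \<in> E" "f \<noteq> e" "v \<in> f" for f
        using only_e'[of f] that by (auto simp: cut_def)
      then show ?thesis by (auto simp: link_def)
    qed
    then show ?thesis
      using vertex_link[OF v(2), of e G G'] e(1) A_subset_E that rtrancl_mono by blast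
  qed
  \<comment> \<open>A crossing of an edge other than \<open>e\<close> stays available, since that
    edge does not contain \<open>v\<close> and is still cut by the larger set.\<close>
  have "(F, F') \<in> ?L\<^sup>*" if FF': "(F, F') \<in> link (cut S)" for F F'
  proof -
    obtain g where g: "g \<in> cut S" "g \<subseteq> F" "g \<subseteq> F'" "F \<in> FF" "F' \<in> FF" using FF' by (auto simp: link_def)
    show ?thesis
    proof (cases "g = e")
      case True then show ?thesis using around g eV by blast
    next
      case False
      then have "v \<notin> g" using only_e[of g] g by (auto simp: cut_def)
      then have "g \<in> cut ?T" using g(1) by (auto simp: cut_def)
      then show ?thesis using g by (auto simp: link_def)
    qed
  qed
  then have "link (cut S) \<subseteq> ?L\<^sup>*" by auto
  then have old: "(link (cut S))\<^sup>* \<subseteq> ?L\<^sup>*" by (metis rtrancl_idemp rtrancl_mono)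
  \<comment> \<open>\<open>G\<close> contains both \<open>v\<close> and \<open>s\<close>, so it
    serves as a hub between the faces at \<open>v\<close> and the faces meeting
    \<open>S\<close>.\<close>
  obtain G where G: "G \<in> FF" "e \<subseteq> G" using edge_on_face e A_subset_E by blast
  then have G': "v \<in> G" "G \<inter> S \<noteq> {}" using eV s by auto
  have "(F, F') \<in> ?L\<^sup>*" if F: "F \<in> FF" "F' \<in> FF" "F \<inter> ?T \<noteq> {}" "F' \<inter> ?T \<noteq> {}" for F F'
  proof -
    have "(F, G) \<in> ?L\<^sup>*" using F(1,3) around[of F G] linked[of F G] old G(1) G' by blast
    moreover have "(G, F') \<in> ?L\<^sup>*" using F(2,4) around[of G F'] linked[of G F'] old G(1) G' by blast
    ultimately show ?thesis by (rule rtrancl_trans)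
  qed
  then have "grown ?T" unfolding grown_def using SW v connT countT by blast
  then show ?thesis using v vS by blast
qed

lemma grown_all: "grown W"
proof -
  obtain w where "w \<in> W" using tree by (auto simp: tree_graph_def connected_graph_def)
  have fin: "finite W" using W_subset_V finite_verts finite_subset by blast
  have "card S < Suc (card W)" if "grown S" for S
    using that card_mono[OF fin, of S] by (simp add: grown_def less_Suc_eq_le)
  then obtain S where S: "grown S" and max: "\<And>T. grown T \<Longrightarrow> card T \<le> card S"
    using ex_has_greatest_nat[of grown "{w}" card "Suc (card W)"] grown_singleton[OF \<open>w \<in> W\<close>]
    by (metis less_imp_le)
  have "S = W"
  proof (rule ccontr)
    assume "S \<noteq> W"
    then obtain v where v: "v \<in> W - S" "grown (insert v S)" using grow[OF S] by blast
    have "finite S" using S fin finite_subset by (auto simp: grown_def)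
    then show False using max[OF v(2)] v(1) by simp
  qed
  then show ?thesis using S by simp
qed

section \<open>Degree sum and counting of incidences\<close>

lemma card_tree_edges: "card A + 1 = card W"
proof -
  have "{e \<in> A. e \<inter> V \<subseteq> W} = A" using ends_A by blast
  then show ?thesis using grown_all by (simp add: grown_def)
qed

text \<open>Double counting of incidences between \<open>W\<close> and the edges: a tree edge has
  two ends in \<open>W\<close>, a cut edge one, and every other edge none, the last by
  \<open>induced\<close>.\<close>

lemma sum_degree: "(\<Sum>v\<in>W. degree_in E v) = 2 * card A + card (cut W)"
proof -
  have fin: "finite W" "finite A" "finite (cut W)"
    using W_subset_V finite_verts A_subset_E finite_edges by (auto simp: cut_def intro: finite_subset)
  define k where "k e = card {v \<in> W. v \<in> e}" for e
  have kA: "k e = 2" if "e \<in> A" for e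
  proof -
    have "{v \<in> W. v \<in> e} = e \<inter> V" using A_ends_eq[OF that] by auto
    then show ?thesis using card_ends that A_subset_E by (auto simp: k_def)
  qed
  have kc: "k e = 1" if "e \<in> cut W" for e
  proof -
    obtain x where x: "x \<in> e" "x \<in> W" "e \<in> E" "\<not> e \<inter> V \<subseteq> W" using \<open>e \<in> cut W\<close> by (auto simp: cut_def)
    then obtain y where "e \<inter> V = {x, y}" "x \<noteq> y" using ends_of[of e x] W_subset_V by blast
    then have "{v \<in> W. v \<in> e} = {x}" using x W_subset_V by auto
    then show ?thesis by (simp add: k_def)
  qed
  have k0: "k e = 0" if "e \<in> E - (A \<union> cut W)" for e
  proof -
    have "{v \<in> W. v \<in> e} = {}" using that induced by (auto simp: cut_def)
    then show ?thesis unfolding k_def by (metis card.empty)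
  qed
  have disj: "A \<inter> cut W = {}" using ends_A by (auto simp: cut_def)
  have "(\<Sum>v\<in>W. degree_in E v) = sum k E"
    unfolding degree_in_def by (rule sum_multicount_gen) (use fin finite_edges in \<open>auto simp: k_def\<close>)
  also have "\<dots> = sum k (A \<union> cut W)"
    using A_subset_E k0 finite_edges by (intro sum.mono_neutral_right) (auto simp: cut_def)
  also have "\<dots> = 2 * card A + card (cut W)"
    using fin disj kA kc by (simp add: sum.union_disjoint)
  finally show ?thesis .
qed

lemma cut_outer_end:
  assumes "f \<in> cut W"
  obtains z where "z \<in> f" "z \<in> V - W"
  using assms by (auto simp: cut_def)

text \<open>Condition (1) and \<open>sum_degree\<close> leave \<open>n\<close> cut edges. Each lies
  on two faces, which both meet \<open>W\<close>, and each face meeting \<open>W\<close> carries two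
  of them; so \<open>n\<close> faces meet \<open>W\<close>, which is all of them.\<close>

lemma all_faces_touched:
  assumes deg: "(\<Sum>v\<in>W. degree_in E v) = n + 2 * (card W - 1)" and FF: "card FF = n"
  shows "card (cut W) = n" and "F \<in> FF \<Longrightarrow> W \<inter> F \<noteq> {}"
proof -
  have "2 * card A + card (cut W) = n + 2 * card A"
    using deg sum_degree card_tree_edges by simp
  then show cutn: "card (cut W) = n" by simp
  let ?T = "{F \<in> FF. W \<inter> F \<noteq> {}}"
  have sides: "card {F \<in> ?T. f \<subseteq> F} = 2" if "f \<in> cut W" for f
  proof -
    have "{F \<in> ?T. f \<subseteq> F} = {F \<in> FF. f \<subseteq> F}" using that by (auto simp: cut_def)
    then show ?thesis using card_sides[of f] that by (simp add: cut_def)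
  qed
  have "(\<Sum>F\<in>?T. card {f \<in> cut W. f \<subseteq> F}) = (\<Sum>f\<in>cut W. 2)"
    by (rule sum_multicount_gen) (use sides finite_faces finite_edges in \<open>auto simp: cut_def\<close>)
  moreover have "(\<Sum>F\<in>?T. card {f \<in> cut W. f \<subseteq> F}) = (\<Sum>F\<in>?T. 2)"
    using card_cut_face by (intro sum.cong) auto
  ultimately have "card ?T = card FF" using cutn FF by simp
  then have "?T = FF" using finite_faces by (intro card_subset_eq) auto
  then show "F \<in> FF \<Longrightarrow> W \<inter> F \<noteq> {}" by blast
qed

section \<open>Consequences once every face meets the tree\<close>

context
  assumes touch: "\<And>F. F \<in> FF \<Longrightarrow> W \<inter> F \<noteq> {}"
begin

lemma faces_linked: "F \<in> FF \<Longrightarrow> F' \<in> FF \<Longrightarrow> (F, F') \<in> (link (cut W))\<^sup>*"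
  using grown_all touch by (auto simp: grown_def Int_commute)

text \<open>Two faces are neighbours if they intersect in a cut edge. Crossing the two cut edges on
  \<open>F\<close> gives two different neighbours, and \<open>faces_linked\<close> gives
  connectedness, so \<open>connected_two_regular_Hamiltonian\<close> applies.\<close>

lemma Hamiltonian_face_cycle:
  obtains Fs where "set Fs = FF" "distinct Fs"
    "\<forall>i. Suc i < length Fs \<longrightarrow> Fs ! i \<inter> Fs ! Suc i \<in> cut W" "hd Fs \<inter> last Fs \<in> cut W"
proof -
  define R where "R = {(F, F'). F \<in> FF \<and> F' \<in> FF \<and> F \<noteq> F' \<and> F \<inter> F' \<in> cut W}"
  have two: "card (R `` {F}) = 2" if F: "F \<in> FF" for F
  proof -
    \<comment> \<open>An edge on \<open>F\<close> has only one face on its other side, and by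
      \<open>face_Int\<close> the two faces share nothing else.\<close>
    have "bij_betw (\<lambda>F'. F \<inter> F') (R `` {F}) {f \<in> cut W. f \<subseteq> F}"
      unfolding bij_betw_def
    proof
      show "inj_on (\<lambda>F'. F \<inter> F') (R `` {F})"
      proof (rule inj_onI)
        fix G H assume GH: "G \<in> R `` {F}" "H \<in> R `` {F}" "F \<inter> G = F \<inter> H"
        then have "F \<inter> G \<in> E" by (auto simp: R_def cut_def)
        then have "card {K \<in> FF. F \<inter> G \<subseteq> K} = 2" by (rule card_sides)
        then obtain a b where ab: "{K \<in> FF. F \<inter> G \<subseteq> K} = {a, b}" by (auto simp: card_2_iff)
        have "{F, G, H} \<subseteq> {K \<in> FF. F \<inter> G \<subseteq> K}" using GH by (auto simp: R_def)
        then show "G = H" using GH unfolding ab by (auto simp: R_def)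
      qed
      show "(\<lambda>F'. F \<inter> F') ` (R `` {F}) = {f \<in> cut W. f \<subseteq> F}"
      proof (intro equalityI subsetI)
        fix f assume "f \<in> (\<lambda>F'. F \<inter> F') ` (R `` {F})"
        then show "f \<in> {f \<in> cut W. f \<subseteq> F}" by (auto simp: R_def)
      next
        fix f assume f: "f \<in> {f \<in> cut W. f \<subseteq> F}"
        then have "f \<in> E" by (simp add: cut_def)
        then obtain a b where ab: "{K \<in> FF. f \<subseteq> K} = {a, b}" "a \<noteq> b"
          using card_sides[of f] by (auto simp: card_2_iff)
        moreover have "F \<in> {K \<in> FF. f \<subseteq> K}" using F f by simp
        ultimately obtain G where G: "G \<in> FF" "f \<subseteq> G" "G \<noteq> F" by (metis (mono_tags, lifting) insertI1 insert_iff mem_Collect_eq)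
        then have "F \<inter> G = f" using face_Int[of F G f] F f \<open>f \<in> E\<close> by auto
        then show "f \<in> (\<lambda>F'. F \<inter> F') ` (R `` {F})" using G F f by (auto simp: R_def)
      qed
    qed
    then show ?thesis using bij_betw_same_card card_cut_face[OF F touch[OF F]] by metis
  qed
  have "link (cut W) \<subseteq> R\<^sup>*"
  proof (rule subrelI)
    fix F F' assume "(F, F') \<in> link (cut W)"
    then obtain f where f: "f \<in> cut W" "f \<subseteq> F" "f \<subseteq> F'" "F \<in> FF" "F' \<in> FF" by (auto simp: link_def)
    show "(F, F') \<in> R\<^sup>*"
    proof (cases "F = F'")
      case False
      then have "F \<inter> F' = f" using face_Int f by (auto simp: cut_def)
      then show ?thesis using f False by (auto simp: R_def)
    qed simp
  qed
  then have conn: "(F, F') \<in> R\<^sup>*" if "F \<in> FF" "F' \<in> FF" for F F'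
    using faces_linked[OF that] rtrancl_mono rtrancl_idemp by (metis subsetD)
  obtain w where "w \<in> W" using tree by (auto simp: tree_graph_def connected_graph_def)
  then have "FF \<noteq> {}" using vertex_on_face W_subset_V by blast
  moreover have "sym R" "irrefl R" "R \<subseteq> FF \<times> FF"
    by (auto simp: R_def sym_def irrefl_def Int_commute)
  ultimately obtain xs where "set xs = FF" "distinct xs"
    "\<forall>i. Suc i < length xs \<longrightarrow> (xs ! i, xs ! Suc i) \<in> R" "(hd xs, last xs) \<in> R"
    using connected_two_regular_Hamiltonian[OF finite_faces, of R] two conn by blast
  then show ?thesis by (intro that) (auto simp: R_def)
qed

abbreviation "uncut \<equiv> {(x, y). adjacent_in V (E - cut W) x y}"

lemma uncut_closed: "(a, b) \<in> uncut \<Longrightarrow> a \<in> W \<longleftrightarrow> b \<in> W"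
  by (auto simp: adjacent_in_def cut_def)

lemma inner_joined: "x \<in> W \<Longrightarrow> y \<in> W \<Longrightarrow> (x, y) \<in> uncut\<^sup>*"
proof -
  assume xy: "x \<in> W" "y \<in> W"
  have "{(x, y). adjacent_in W A x y} \<subseteq> uncut"
  proof (clarify)
    fix a b assume "adjacent_in W A a b"
    then obtain e where e: "e \<in> A" "e \<inter> W = {a, b}" "a \<noteq> b" by (auto simp: adjacent_in_def)
    then show "adjacent_in V (E - cut W) a b"
      using A_ends_eq[of e] A_subset_E ends_A[of e] by (auto simp: adjacent_in_def cut_def)
  qed
  moreover have "(x, y) \<in> {(x, y). adjacent_in W A x y}\<^sup>*"
    using tree xy path_in_joins_iff[of x W A y] by (auto simp: tree_graph_def connected_graph_def)
  ultimately show ?thesis using rtrancl_mono by blast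
qed

text \<open>A chain of faces across cut edges leads from \<open>x\<close> to \<open>y\<close>.
  Consecutive faces share the outer end of a cut edge, where the walk passes from the outer arc of
  one face to that of the next.\<close>

lemma complement_joined:
  assumes "x \<in> V - W" "y \<in> V - W"
  shows "(x, y) \<in> uncut\<^sup>*"
proof -
  obtain F G where F: "F \<in> FF" "x \<in> F" and G: "G \<in> FF" "y \<in> G" using vertex_on_face assms by blast
  \<comment> \<open>The claim for all outer vertices of the current face is what carries over to the
    next face.\<close>
  have "\<forall>z \<in> G \<inter> (V - W). (x, z) \<in> uncut\<^sup>*"
    using faces_linked[OF F(1) G(1)]
  proof (induction rule: rtrancl_induct)
    case base
    show ?case using outer_joined[OF F(1) touch[OF F(1)]] F assms by blast
  next
    case (step H K)
    then obtain f where f: "f \<in> cut W" "f \<subseteq> H" "f \<subseteq> K" "K \<in> FF" by (auto simp: link_def)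
    obtain z where z: "z \<in> f" "z \<in> V - W" by (rule cut_outer_end[OF f(1)])
    then have xz: "(x, z) \<in> uncut\<^sup>*" using step.IH f by blast
    show ?case
    proof
      fix z' assume "z' \<in> K \<inter> (V - W)"
      then have "(z, z') \<in> uncut\<^sup>*" using outer_joined[OF f(4) touch[OF f(4)]] z f by blast
      then show "(x, z') \<in> uncut\<^sup>*" using xz by (rule rtrancl_trans[rotated])
    qed
  qed
  then show ?thesis using G assms by blast
qed

lemma complement_nonempty: "V - W \<noteq> {}"
proof -
  obtain w where "w \<in> W" using tree by (auto simp: tree_graph_def connected_graph_def)
  then obtain F where F: "F \<in> FF" using vertex_on_face W_subset_V by blast
  have "card {f \<in> cut W. f \<subseteq> F} \<noteq> 0" using card_cut_face[OF F touch[OF F]] by simp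
  then obtain f where "f \<in> cut W" by (metis (no_types, lifting) Collect_empty_eq card.empty)
  then show ?thesis using cut_outer_end by blast
qed

text \<open>Uncut edges never change sides, and either side is joined. By \<open>induced\<close> the
  uncut edges inside \<open>W\<close> are exactly \<open>A\<close>, so one component is the tree
  itself, including its edge set.\<close>

lemma components_of_complement:
  "graph_components V (E - cut W) = {(W, A), (V - W, {e \<in> E - cut W. e \<inter> V \<subseteq> V - W})}"
proof -
  have comp: "{v \<in> V. \<exists>xs. path_in V (E - cut W) xs \<and> hd xs = u \<and> last xs = v} = (if u \<in> W then W else V - W)"
    if u: "u \<in> V" for u
  proof -
    have "(u, v) \<in> uncut\<^sup>* \<longleftrightarrow> (u \<in> W \<longleftrightarrow> v \<in> W)" if v: "v \<in> V" for v
    proof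
      assume uv: "(u, v) \<in> uncut\<^sup>*"
      show "u \<in> W \<longleftrightarrow> v \<in> W"
        using rtrancl_closed[OF uv, of "{z. u \<in> W \<longleftrightarrow> z \<in> W}"] uncut_closed by blast
    qed (use u v inner_joined complement_joined in blast)
    then show ?thesis using path_in_joins_iff[OF u, of "E - cut W"] W_subset_V by auto
  qed
  have "{e \<in> E - cut W. e \<inter> V \<subseteq> W} = A"
    using induced A_subset_E ends_A by (auto simp: cut_def)
  moreover obtain w where "w \<in> W" using tree by (auto simp: tree_graph_def connected_graph_def)
  moreover have "(\<lambda>u. if u \<in> W then W else V - W) ` V = {W, V - W}"
    using complement_nonempty \<open>w \<in> W\<close> W_subset_V by auto
  moreover have "graph_components V (E - cut W) =
      (\<lambda>C. (C, {e \<in> E - cut W. e \<inter> V \<subseteq> C})) ` (\<lambda>u. if u \<in> W then W else V - W) ` V"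
    unfolding graph_components_def image_image by (intro image_cong) (simp_all add: comp Let_def)
  ultimately show ?thesis by simp
qed

end

end

text \<open>The witness is \<open>cut W\<close>, taken with all of \<open>V\<close> as its
  vertices.\<close>

lemma proper_tree_imp_type_II:
  assumes "polyhedral_incidence V E (map_faces X V E)" and "card (map_faces X V E) = n"
    and T: "proper_tree X V E n W A"
  shows "\<exists>D. proper_graph_type_II X V E n V D"
proof -
  interpret polyhedral_incidence V E "map_faces X V E" by fact
  interpret tree_in_faces V E "map_faces X V E" W A
    by unfold_locales (use T in \<open>auto simp: proper_tree_def\<close>)
  have deg: "(\<Sum>v\<in>W. degree_in E v) = n + 2 * (card W - 1)" using T by (simp add: proper_tree_def)
  note cutn = all_faces_touched(1)[OF deg assms(2)]
  note touch = all_faces_touched(2)[OF deg assms(2)]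
  obtain Fs where Fs: "set Fs = map_faces X V E" "distinct Fs"
    "\<forall>i. Suc i < length Fs \<longrightarrow> Fs ! i \<inter> Fs ! Suc i \<in> cut W" "hd Fs \<inter> last Fs \<in> cut W"
    by (rule Hamiltonian_face_cycle[OF touch])
  have len: "length Fs = n" using Fs assms(2) distinct_card by metis
  obtain w where w: "w \<in> W" using tree by (auto simp: tree_graph_def connected_graph_def)
  then have "Fs \<noteq> []" using Fs(1) vertex_on_face[of w] W_subset_V by auto
  then have closing: "Fs ! 0 \<inter> Fs ! (n - 1) \<in> cut W"
    using Fs(4) len by (simp add: hd_conv_nth last_conv_nth)
  have "admissible_graph X V E n V (cut W)"
    unfolding admissible_graph_def
  proof (intro conjI)
    show "subgraph_of V (cut W) V E" by (auto simp: subgraph_of_def cut_def)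
    show "card (cut W) = n" by (rule cutn)
    show "\<forall>F\<in>map_faces X V E. card (boundary_edges (cut W) F) = 2"
      using card_cut_face touch by (simp add: boundary_edges_def)
    show "\<exists>Fs. length Fs = n \<and> distinct Fs \<and> set Fs \<subseteq> map_faces X V E \<and>
        (\<forall>i. Suc i < n \<longrightarrow> Fs ! i \<inter> Fs ! Suc i \<in> cut W) \<and> Fs ! 0 \<inter> Fs ! (n - 1) \<in> cut W"
      using Fs len closing by (intro exI[of _ Fs]) auto
  qed
  moreover have "graph_components V (E - cut W) = {(W, A), (V - W, {e \<in> E - cut W. e \<inter> V \<subseteq> V - W})}"
    by (rule components_of_complement[OF touch])
  moreover have "W \<noteq> V - W" using w by blast
  ultimately have "proper_graph_type_II X V E n V (cut W)"
    using T by (simp add: proper_graph_type_II_def)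
  then show ?thesis by blast
qed

section \<open>Incidences of a map on a surface\<close>

text \<open>For \<open>z = cis t\<close> with \<open>0 \<le> t < 2 * pi\<close>, the index is the
  integer part of \<open>t * p / (2 * pi)\<close>.\<close>

lemma cis_arcs_cover:
  assumes "p > (0 :: nat)" "norm z = 1"
  shows "\<exists>j<p. z \<in> cis ` {2 * pi * real j / real p .. 2 * pi * real (Suc j) / real p}"
proof -
  obtain t where t: "0 \<le> t" "t < 2 * pi" "z = cis t"
    using Arg2pi_ge_0[of z] Arg2pi_lt_2pi[of z] Arg2pi_eq[of z] assms(2) by (metis cis_conv_exp mult_1 of_real_1)
  define j where "j = nat \<lfloor>t * p / (2 * pi)\<rfloor>"
  have "real j = real_of_int \<lfloor>t * p / (2 * pi)\<rfloor>" using t by (simp add: j_def)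
  then have "real j \<le> t * p / (2 * pi)" "t * p / (2 * pi) < real j + 1" by linarith+
  then have j: "2 * pi * real j \<le> t * p" "t * p < 2 * pi * real (Suc j)"
    by (simp_all add: field_simps)
  have "2 * pi * real j < 2 * pi * p" using j(1) t assms(1)
    by (meson le_less_trans mult_strict_right_mono of_nat_0_less_iff)
  then have "j < p" by simp
  moreover have "2 * pi * real j / p \<le> t" "t \<le> 2 * pi * real (Suc j) / p"
    using j assms(1) by (simp_all add: field_simps)
  ultimately show ?thesis using t by auto
qed

lemma embedding_map_inj_on: "embedding_map X Y f \<Longrightarrow> inj_on f (topspace X)"
  by (simp add: embedding_map_def homeomorphic_imp_injective_map)

context
  fixes X :: "'a topology" and V :: "'a set" and E :: "'a set set"
  assumes graph: "embedded_simple_graph X V E"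
begin

lemma edge_ends: "e \<in> E \<Longrightarrow> card (e \<inter> V) = 2"
proof -
  assume "e \<in> E"
  then obtain g :: "real \<Rightarrow> 'a" where g: "embedding_map (top_of_set {0..1}) X g" "e \<inter> V = {g 0, g 1}"
    using graph by (auto simp: embedded_simple_graph_def)
  then have "inj_on g {0..1}" using embedding_map_inj_on[OF g(1)] by simp
  then have "g 0 \<noteq> g 1" using inj_onD[of g "{0..1}" 0 1] by auto
  then show ?thesis using g by simp
qed

text \<open>An arc is an injective image of an interval. It follows later that an edge cannot
  consist of vertices only.\<close>

lemma edge_infinite: "e \<in> E \<Longrightarrow> infinite e"
proof -
  assume "e \<in> E"
  then obtain g :: "real \<Rightarrow> 'a" where g: "embedding_map (top_of_set {0..1}) X g" "g ` {0..1} = e"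
    using graph by (auto simp: embedded_simple_graph_def)
  then have "inj_on g {0..1}" using embedding_map_inj_on[OF g(1)] by simp
  then show ?thesis using g(2) finite_imageD infinite_Icc[of "0 :: real" 1] by fastforce
qed

lemma edges_Int: "e \<in> E \<Longrightarrow> f \<in> E \<Longrightarrow> e \<noteq> f \<Longrightarrow> e \<inter> f \<subseteq> V"
  and edges_eqI: "e \<in> E \<Longrightarrow> f \<in> E \<Longrightarrow> e \<inter> V = f \<inter> V \<Longrightarrow> e = f"
  using graph unfolding embedded_simple_graph_def by blast+

lemma component_avoids_graph:
  "C \<in> complementary_components X V E \<Longrightarrow> C \<inter> (V \<union> \<Union>E) = {}"
  using connected_components_of_subset unfolding complementary_components_def by fastforce

text \<open>The unit circle is cut at the \<open>p\<close>-th roots of unity, and \<open>h\<close>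
  carries the pieces to the boundary. The open cell avoids the graph, so vertices and edges in the
  closed face must lie on these \<open>p\<close> arcs.\<close>

lemma polygonal_disc_boundary:
  assumes C: "C \<in> complementary_components X V E" and p: "p \<ge> 3" and disc: "polygonal_disc X V E p C"
  shows "\<exists>u e. boundary_cycle V E (X closure_of C) p u e \<and> X closure_of C = C \<union> (\<Union>j<p. e j)"
proof -
  let ?F = "X closure_of C"
  obtain h :: "complex \<Rightarrow> 'a" where h: "embedding_map (top_of_set (cball 0 1)) X h"
    "h ` cball 0 1 = ?F" "h ` ball 0 1 = C"
    and hV: "\<And>j. j < p \<Longrightarrow> h (cis (2 * pi * real j / real p)) \<in> V"
    and hE: "\<And>j. j < p \<Longrightarrow> h ` cis ` {2 * pi * real j / real p .. 2 * pi * real (Suc j) / real p} \<in> E"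
    using disc by (auto simp: polygonal_disc_def)
  have inj: "inj_on h (cball 0 1)" using embedding_map_inj_on[OF h(1)] by simp
  \<comment> \<open>The formulas are used for all natural \<open>j\<close>; the period
    \<open>p\<close> then comes from that of \<open>cis\<close>.\<close>
  define a where "a j = cis (2 * pi * real j / real p)" for j
  define arc where "arc j = cis ` {2 * pi * real j / real p .. 2 * pi * real (Suc j) / real p}" for j
  define u where "u j = h (a j)" for j
  define e where "e j = h ` arc j" for j
  have shift: "2 * pi * real (j + p) / real p = 2 * pi * real j / real p + 2 * pi" for j
    using p by (simp add: field_simps)
  have cis_shift: "cis (t + 2 * pi) = cis t" for t by (simp add: cis_mult[symmetric])
  have a_per: "a (j + p) = a j" for j
    unfolding a_def shift by (rule cis_shift)
  have arc_per: "arc (j + p) = arc j" for j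
  proof -
    have "arc (j + p) = cis ` ((\<lambda>t. t + 2 * pi) ` {2 * pi * real j / real p .. 2 * pi * real (Suc j) / real p})"
      unfolding arc_def using shift[of j] shift[of "Suc j"] by simp
    then show ?thesis unfolding arc_def image_image cis_shift .
  qed
  have per: "u (j + p) = u j" "e (j + p) = e j" for j
    by (simp_all add: u_def e_def a_per arc_per)
  have "inj_on a {..<p}"
    using Complex.bij_betw_roots_unity[of p] p unfolding a_def bij_betw_def by simp
  moreover have "a ` {..<p} \<subseteq> cball 0 1" by (auto simp: a_def)
  then have "inj_on h (a ` {..<p})" by (rule inj_on_subset[OF inj])
  ultimately have "inj_on (h \<circ> a) {..<p}" by (rule comp_inj_on)
  then have inj_u: "inj_on u {..<p}" by (simp add: u_def[abs_def] comp_def)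
  have p0: "p > 0" using p by simp
  have "u i \<in> V" "e i \<in> E" if "i < p" for i
    using hV[OF that] hE[OF that] by (simp_all only: u_def a_def e_def arc_def)
  then have mods: "u (j mod p) \<in> V" "e (j mod p) \<in> E" for j using p0 by simp_all
  have uV: "u j \<in> V" for j using mods(1)[of j] periodic_mod[of u p j, OF per(1)] by simp
  have eE: "e j \<in> E" for j using mods(2)[of j] periodic_mod[of e p j, OF per(2)] by simp
  have "a j \<in> arc j" "a (Suc j) \<in> arc j" for j
    unfolding a_def arc_def using p0 by (auto intro!: imageI divide_right_mono)
  then have u_in_e: "u j \<in> e j" "u (Suc j) \<in> e j" for j by (simp_all add: u_def e_def)
  have u_neq: "u j \<noteq> u (Suc j)" for j
  proof -
    have "j mod p \<noteq> Suc j mod p" using p by (simp add: mod_Suc)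
    then have "u (j mod p) \<noteq> u (Suc j mod p)" using inj_onD[OF inj_u, of "j mod p" "Suc j mod p"] p0 by auto
    then show ?thesis using periodic_mod[of u p, OF per(1)] by simp
  qed
  have eu: "e j \<inter> V = {u j, u (Suc j)}" for j
  proof -
    have "{u j, u (Suc j)} \<subseteq> e j \<inter> V" using u_in_e uV by auto
    moreover have "card {u j, u (Suc j)} = card (e j \<inter> V)" using u_neq edge_ends[OF eE] by simp
    moreover have "finite (e j \<inter> V)" by (rule card_ge_0_finite) (simp add: edge_ends[OF eE])
    ultimately show ?thesis using card_subset_eq[of "e j \<inter> V" "{u j, u (Suc j)}"] by simp
  qed
  have e_sub: "e j \<subseteq> ?F" for j
    unfolding e_def h(2)[symmetric] by (intro image_mono) (auto simp: arc_def)
  have cover: "?F = C \<union> (\<Union>j<p. e j)"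
  proof
    show "?F \<subseteq> C \<union> (\<Union>j<p. e j)"
    proof
      fix y assume "y \<in> ?F"
      then have "y \<in> h ` cball 0 1" by (simp only: h(2))
      then obtain z where z: "y = h z" "norm z \<le> 1" by auto
      show "y \<in> C \<union> (\<Union>j<p. e j)"
      proof (cases "norm z = 1")
        case True
        obtain j where "j < p" "z \<in> arc j"
          using cis_arcs_cover[OF p0 True] unfolding arc_def by blast
        then have "j < p" "y \<in> e j" unfolding e_def z(1) by (blast intro: imageI)+
        then show ?thesis by blast
      next
        case False
        then have "z \<in> ball 0 1" using z(2) by simp
        then have "y \<in> h ` ball 0 1" unfolding z(1) by (rule imageI)
        then show ?thesis by (simp only: h(3) UnI1)
      qed
    qed
    have "h ` ball 0 1 \<subseteq> h ` cball 0 1" by (intro image_mono) auto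
    then have "C \<subseteq> ?F" by (simp only: h(2,3))
    then show "C \<union> (\<Union>j<p. e j) \<subseteq> ?F" using e_sub by blast
  qed
  have avoid: "C \<inter> (V \<union> \<Union>E) = {}" by (rule component_avoids_graph[OF C])
  have "u ` {..<p} = V \<inter> ?F"
  proof
    show "u ` {..<p} \<subseteq> V \<inter> ?F" using uV u_in_e e_sub by blast
    show "V \<inter> ?F \<subseteq> u ` {..<p}"
    proof
      fix x assume x: "x \<in> V \<inter> ?F"
      then have "x \<in> (\<Union>j<p. e j)" using cover avoid by blast
      then obtain j where "x \<in> e j" by blast
      then have "x \<in> e j \<inter> V" using x by blast
      then have "x = u j \<or> x = u (Suc j)" unfolding eu by blast
      then have "x = u (j mod p) \<or> x = u (Suc j mod p)" using periodic_mod[of u p, OF per(1)] by simp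
      then show "x \<in> u ` {..<p}" using p0 by auto
    qed
  qed
  moreover have "e ` {..<p} = {f \<in> E. f \<subseteq> ?F}"
  proof
    show "e ` {..<p} \<subseteq> {f \<in> E. f \<subseteq> ?F}" using eE e_sub by auto
    show "{f \<in> E. f \<subseteq> ?F} \<subseteq> e ` {..<p}"
    proof
      fix f assume f: "f \<in> {f \<in> E. f \<subseteq> ?F}"
      show "f \<in> e ` {..<p}"
      proof (rule ccontr)
        \<comment> \<open>A further edge would be covered by the \<open>p\<close> arcs but meet each
          of them in vertices only; it would then lie in the finite set \<open>V\<close>.\<close>
        assume n: "f \<notin> e ` {..<p}"
        have "f \<subseteq> (\<Union>j<p. e j)" using f cover avoid by blast
        moreover have "f \<inter> e j \<subseteq> V" if "j < p" for j
          using edges_Int[of f "e j"] f eE n that by auto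
        ultimately have "f \<subseteq> V" by blast
        then show False using edge_infinite[of f] f graph finite_subset by (auto simp: embedded_simple_graph_def)
      qed
    qed
  qed
  ultimately have "boundary_cycle V E ?F p u e"
    using p inj_u per eu by (simp add: boundary_cycle_def)
  then show ?thesis using cover by blast
qed

end

lemma face_boundary:
  assumes M: "map_on_surface X V E" and F: "F \<in> map_faces X V E"
  obtains C p u e where "C \<in> complementary_components X V E" "F = X closure_of C"
    "boundary_cycle V E F p u e" "F = C \<union> (\<Union>j<p. e j)"
proof -
  have graph: "embedded_simple_graph X V E" using M by (simp add: map_on_surface_def)
  obtain C where C: "C \<in> complementary_components X V E" "F = X closure_of C"
    using F by (auto simp: map_faces_def)
  then obtain p where "p \<ge> 3" "polygonal_disc X V E p C" using M by (auto simp: map_on_surface_def)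
  then show ?thesis using polygonal_disc_boundary[OF graph C(1)] that C by metis
qed

text \<open>Different components are disjoint and the open cell of \<open>F\<close> avoids the
  graph, so a common point of the two closed faces is on a boundary arc of \<open>F\<close>.\<close>

lemma faces_Int_on_graph:
  assumes M: "map_on_surface X V E" and F: "F \<in> map_faces X V E" "F' \<in> map_faces X V E" "F \<noteq> F'"
    and y: "y \<in> F" "y \<in> F'"
  shows "\<exists>e\<in>E. y \<in> e \<and> e \<subseteq> F"
proof -
  have graph: "embedded_simple_graph X V E" using M by (simp add: map_on_surface_def)
  obtain C p u e where C: "C \<in> complementary_components X V E" "F = X closure_of C"
    "boundary_cycle V E F p u e" "F = C \<union> (\<Union>j<p. e j)" by (rule face_boundary[OF M F(1)])
  obtain C' p' u' e' where C': "C' \<in> complementary_components X V E" "F' = X closure_of C'"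
    "boundary_cycle V E F' p' u' e'" "F' = C' \<union> (\<Union>j<p'. e' j)" by (rule face_boundary[OF M F(2)])
  have eE: "e j \<in> E \<and> e j \<subseteq> F" if "j < p" for j
  proof -
    have "e j \<in> {f \<in> E. f \<subseteq> F}" using C(3) that unfolding boundary_cycle_def by blast
    then show ?thesis by simp
  qed
  have e'E: "e' j \<in> E" if "j < p'" for j
    using C'(3) that unfolding boundary_cycle_def by blast
  have "C \<noteq> C'" using C(2) C'(2) F(3) by auto
  then have "C \<inter> C' = {}"
    using pairwiseD[OF pairwise_disjoint_connected_components_of] C(1) C'(1)
    unfolding complementary_components_def disjnt_def by blast
  moreover have "C \<inter> (\<Union>j<p'. e' j) = {}"
    using component_avoids_graph[OF graph C(1)] e'E by blast
  ultimately have "y \<notin> C" using y(2) C'(4) by blast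
  then obtain j where "j < p" "y \<in> e j" using y(1) C(4) by auto
  then show ?thesis using eE by blast
qed

section \<open>The dual of a polyhedral map\<close>

text \<open>A cycle minus the edge \<open>f0\<close> is still connected. For a face of the primal
  map this becomes \<open>vertex_link\<close> at the corresponding dual vertex.\<close>

lemma boundary_cycle_link:
  assumes c: "boundary_cycle V E F p u e" and v: "v \<in> V \<inter> F" "w \<in> V \<inter> F"
  shows "(v, w) \<in> {(x, y). \<exists>f\<in>E. f \<noteq> f0 \<and> f \<subseteq> F \<and> f \<inter> V = {x, y}}\<^sup>*" (is "_ \<in> ?R\<^sup>*")
proof -
  \<comment> \<open>The rotation puts \<open>f0\<close>, if it is on the boundary, at position
    \<open>p - 1\<close>.\<close>
  obtain r where r: "\<And>j. j < p - 1 \<Longrightarrow> e (j + r) \<noteq> f0"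
  proof (cases "f0 \<in> e ` {..<p}")
    case True
    then obtain k where k: "k < p" "f0 = e k" by auto
    have c': "boundary_cycle V E F p (\<lambda>j. u (j + Suc k)) (\<lambda>j. e (j + Suc k))"
      by (rule boundary_cycle_rotate[OF c])
    have last: "e (p - 1 + Suc k) = e k" using c by (auto simp: boundary_cycle_def add.commute[of _ k])
    have "e (j + Suc k) \<noteq> f0" if "j < p - 1" for j
    proof
      assume "e (j + Suc k) = f0"
      then have "e (j + Suc k) = e (p - 1 + Suc k)" using last k by simp
      moreover have "j < p" "p - 1 < p" using that by linarith+
      ultimately have "j = p - 1" using inj_onD[OF boundary_cycle_inj_edges[OF c'], of j "p - 1"] by simp
      then show False using that by simp
    qed
    then show ?thesis by (rule that)
  next
    case False
    then have "e (j + 0) \<noteq> f0" if "j < p - 1" for j using that by auto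
    then show ?thesis by (rule that)
  qed
  define u' e' where "u' j = u (j + r)" and "e' j = e (j + r)" for j
  have c': "boundary_cycle V E F p u' e'"
    unfolding u'_def e'_def by (rule boundary_cycle_rotate[OF c])
  have step: "(u' j, u' (Suc j)) \<in> ?R" if "Suc j < p" for j
  proof -
    have "e' ` {..<p} = {f \<in> E. f \<subseteq> F}" "e' j \<inter> V = {u' j, u' (Suc j)}"
      using c' by (auto simp: boundary_cycle_def)
    then have "e' j \<in> E" "e' j \<subseteq> F" "e' j \<inter> V = {u' j, u' (Suc j)}" using that by auto
    moreover have "e' j \<noteq> f0" using r[of j] that by (simp add: e'_def)
    ultimately show ?thesis by blast
  qed
  have up: "(u' i, u' j) \<in> ?R\<^sup>*" if "i \<le> j" "j < p" for i j
    using that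
  proof (induction j rule: dec_induct)
    case (step n)
    then have "(u' i, u' n) \<in> ?R\<^sup>*" "(u' n, u' (Suc n)) \<in> ?R" using \<open>\<And>j. Suc j < p \<Longrightarrow> (u' j, u' (Suc j)) \<in> ?R\<close> by auto
    then show ?case by (rule rtrancl_into_rtrancl)
  qed simp
  have "sym ?R" by (auto simp: sym_def insert_commute)
  then have sym: "sym (?R\<^sup>*)" by (rule sym_rtrancl)
  have "u' ` {..<p} = V \<inter> F" using c' by (simp add: boundary_cycle_def)
  then have "v \<in> u' ` {..<p}" "w \<in> u' ` {..<p}" using v by simp_all
  then obtain i j where "v = u' i" "w = u' j" "i < p" "j < p" by auto
  then show ?thesis using up[of i j] up[of j i] symD[OF sym] by (cases "i \<le> j") auto
qed

text \<open>Incidences are transported through the duality bijections. \<open>vertex_link\<close> of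
  the dual comes from the boundary cycles of the faces of the primal map, and
  \<open>face_Int\<close> from its polyhedrality.\<close>

lemma dual_polyhedral_incidence:
  assumes P: "polyhedral_map X V E" and D: "is_dual_map X V E VK EK"
  shows "polyhedral_incidence VK EK (map_faces X VK EK)" and "card (map_faces X VK EK) = card V"
proof -
  define M where "M = map_faces X V E"
  define K where "K = map_faces X VK EK"
  have map_M: "map_on_surface X V E" using P by (simp add: polyhedral_map_def)
  have graph_M: "embedded_simple_graph X V E" using map_M by (simp add: map_on_surface_def)
  have map_K: "map_on_surface X VK EK" using D by (simp add: is_dual_map_def)
  have graph_K: "embedded_simple_graph X VK EK" using map_K by (simp add: map_on_surface_def)
  obtain \<phi> \<psi> \<theta> where \<phi>: "bij_betw \<phi> M VK" and \<psi>: "bij_betw \<psi> E EK" and \<theta>: "bij_betw \<theta> V K"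
    and ends_all: "\<forall>e\<in>E. \<psi> e \<inter> VK = \<phi> ` {F \<in> M. e \<subseteq> F}"
    and side_all: "\<forall>v\<in>V. \<forall>e\<in>E. \<psi> e \<subseteq> \<theta> v \<longleftrightarrow> v \<in> e"
    using D unfolding is_dual_map_def M_def K_def by blast
  have ends: "\<psi> e \<inter> VK = \<phi> ` {F \<in> M. e \<subseteq> F}" if "e \<in> E" for e
    using ends_all that by blast
  have side: "\<psi> e \<subseteq> \<theta> v \<longleftrightarrow> v \<in> e" if "v \<in> V" "e \<in> E" for v e
    using side_all that by blast
  have \<phi>_inj: "F = F'" if "F \<in> M" "F' \<in> M" "\<phi> F = \<phi> F'" for F F'
    using \<phi> that by (auto simp: bij_betw_def inj_on_def)
  have \<phi>E: "\<exists>F\<in>M. x = \<phi> F" if "x \<in> VK" for x using \<phi> that by (auto simp: bij_betw_def)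
  have \<psi>E: "\<exists>e\<in>E. f = \<psi> e" if "f \<in> EK" for f using \<psi> that by (auto simp: bij_betw_def)
  have \<psi>EK: "\<psi> e \<in> EK" if "e \<in> E" for e using \<psi> that by (auto simp: bij_betw_def)
  have \<theta>E: "\<exists>v\<in>V. G = \<theta> v" if "G \<in> K" for G using \<theta> that by (auto simp: bij_betw_def)
  have \<theta>K: "\<theta> v \<in> K" if "v \<in> V" for v using \<theta> that by (auto simp: bij_betw_def)
  have end_iff: "\<phi> F \<in> \<psi> e \<longleftrightarrow> e \<subseteq> F" if "e \<in> E" "F \<in> M" for e F
  proof -
    have "\<phi> F \<in> VK" using \<phi> that(2) by (auto simp: bij_betw_def)
    then have "\<phi> F \<in> \<psi> e \<longleftrightarrow> \<phi> F \<in> \<phi> ` {F \<in> M. e \<subseteq> F}" using ends[OF that(1)] by blast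
    also have "\<dots> \<longleftrightarrow> e \<subseteq> F" using \<phi>_inj that(2) by blast
    finally show ?thesis .
  qed
  have cyc_M: "\<exists>p u e. boundary_cycle V E F p u e" if "F \<in> M" for F
    using face_boundary[OF map_M that[unfolded M_def]] by metis
  have cyc_K: "\<exists>p u e. boundary_cycle VK EK F p u e" if "F \<in> K" for F
    using face_boundary[OF map_K that[unfolded K_def]] by metis
  have on_edge: "\<exists>e\<in>E'. e \<subseteq> F \<and> x \<in> e" if "boundary_cycle V' E' F p u e" "x \<in> V' \<inter> F"
    for V' and E' :: "'a set set" and F p u e x
  proof -
    have "x \<in> u ` {..<p}" using that by (auto simp: boundary_cycle_def)
    then obtain j where j: "j < p" "x = u j" by auto
    have "e ` {..<p} = {f \<in> E'. f \<subseteq> F}" "e j \<inter> V' = {u j, u (Suc j)}"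
      using that(1) by (auto simp: boundary_cycle_def)
    then show ?thesis using j by (intro bexI[of _ "e j"]) auto
  qed
  \<comment> \<open>The duality is given by edge incidences; vertices and faces are related through
    a boundary edge containing the vertex.\<close>
  have incid: "\<phi> F \<in> \<theta> v \<longleftrightarrow> v \<in> F" if FV: "F \<in> M" "v \<in> V" for F v
  proof
    assume "v \<in> F"
    then obtain e where "e \<in> E" "e \<subseteq> F" "v \<in> e" using cyc_M[OF FV(1)] on_edge FV(2) by blast
    then show "\<phi> F \<in> \<theta> v" using end_iff[of e F] side[of v e] FV by blast
  next
    assume "\<phi> F \<in> \<theta> v"
    moreover have "\<phi> F \<in> VK" using \<phi> FV(1) by (auto simp: bij_betw_def)
    ultimately obtain f where f: "f \<in> EK" "f \<subseteq> \<theta> v" "\<phi> F \<in> f"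
      using cyc_K[OF \<theta>K[OF FV(2)]] on_edge by blast
    then obtain e where "e \<in> E" "f = \<psi> e" using \<psi>E by blast
    then show "v \<in> F" using f end_iff[of e F] side[of v e] FV by blast
  qed
  show "card (map_faces X VK EK) = card V"
    using bij_betw_same_card[OF \<theta>] by (simp add: K_def)
  have two_ends: "e \<inter> V = {v, w}" if "e \<in> E" "v \<in> e \<inter> V" "w \<in> e \<inter> V" "v \<noteq> w" for e v w
  proof -
    have "card (e \<inter> V) = 2" by (rule edge_ends[OF graph_M that(1)])
    then show ?thesis using that by (metis card_2_iff doubleton_eq_iff insertE singletonD)
  qed
  show "polyhedral_incidence VK EK (map_faces X VK EK)"
    unfolding K_def[symmetric]
  proof
    show "finite VK" "finite EK" using graph_K by (auto simp: embedded_simple_graph_def)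
    have "finite V" using graph_M by (auto simp: embedded_simple_graph_def)
    then show "finite K" using \<theta> bij_betw_finite by blast
    show "card (e \<inter> VK) = 2" if "e \<in> EK" for e by (rule edge_ends[OF graph_K that])
    show "e = f" if "e \<in> EK" "f \<in> EK" "e \<inter> VK = f \<inter> VK" for e f by (rule edges_eqI[OF graph_K that])
    show "\<exists>p u e. boundary_cycle VK EK F p u e" if "F \<in> K" for F by (rule cyc_K[OF that])
    show "card {F \<in> K. f \<subseteq> F} = 2" if "f \<in> EK" for f
    proof -
      obtain e where e: "e \<in> E" "f = \<psi> e" using \<psi>E \<open>f \<in> EK\<close> by blast
      have "K = \<theta> ` V" using \<theta> by (simp add: bij_betw_def)
      then have "{F \<in> K. f \<subseteq> F} = \<theta> ` (e \<inter> V)" using side e by auto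
      moreover have "inj_on \<theta> (e \<inter> V)" using \<theta> by (auto simp: bij_betw_def intro: inj_on_subset)
      ultimately show ?thesis using edge_ends[OF graph_M e(1)] by (simp add: card_image)
    qed
    show "\<exists>F\<in>K. x \<in> F" if "x \<in> VK" for x
    proof -
      obtain F where F: "F \<in> M" "x = \<phi> F" using \<phi>E \<open>x \<in> VK\<close> by blast
      then obtain p u e where "boundary_cycle V E F p u e" using cyc_M by blast
      then have "u ` {..<p} = V \<inter> F" "0 \<in> {..<p}" by (auto simp: boundary_cycle_def)
      then have "u 0 \<in> V \<inter> F" by blast
      then show ?thesis using incid[OF F(1)] F(2) \<theta>K by blast
    qed
    show "(F, F') \<in> {(G, G'). G \<in> K \<and> G' \<in> K \<and> (\<exists>f\<in>EK. f \<noteq> e \<and> x \<in> f \<and> f \<subseteq> G \<and> f \<subseteq> G')}\<^sup>*"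
      (is "_ \<in> ?L\<^sup>*")
      if x: "x \<in> VK" and e: "e \<in> EK" and F: "F \<in> K" "x \<in> F" and F': "F' \<in> K" "x \<in> F'" for x e F F'
    proof -
      obtain H where H: "H \<in> M" "x = \<phi> H" using \<phi>E x by blast
      obtain e0 where e0: "e0 \<in> E" "e = \<psi> e0" using \<psi>E e by blast
      obtain v w where vw: "v \<in> V" "F = \<theta> v" "w \<in> V" "F' = \<theta> w" using \<theta>E F(1) F'(1) by metis
      then have vw_H: "v \<in> V \<inter> H" "w \<in> V \<inter> H" using incid[OF H(1)] F F' H by auto
      \<comment> \<open>A walk along the boundary of the primal face \<open>H\<close> that avoids
        \<open>e0\<close> becomes a walk through the dual faces at \<open>x\<close> that does not
        cross \<open>e\<close>.\<close>
      obtain p u d where "boundary_cycle V E H p u d" using cyc_M[OF H(1)] by blast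
      then have "(v, w) \<in> {(x, y). \<exists>f\<in>E. f \<noteq> e0 \<and> f \<subseteq> H \<and> f \<inter> V = {x, y}}\<^sup>*" (is "_ \<in> ?R\<^sup>*")
        by (rule boundary_cycle_link[OF _ vw_H])
      then have "(\<theta> v, \<theta> w) \<in> ?L\<^sup>*"
      proof (induction rule: rtrancl_induct)
        case (step y z)
        then obtain f where f: "f \<in> E" "f \<noteq> e0" "f \<subseteq> H" "f \<inter> V = {y, z}" by blast
        then have yz: "y \<in> V" "z \<in> V" "y \<in> f" "z \<in> f" by auto
        have "x \<in> \<psi> f" using end_iff[OF f(1) H(1)] f(3) H(2) by simp
        moreover have "\<psi> f \<subseteq> \<theta> y" "\<psi> f \<subseteq> \<theta> z" using side yz f(1) by simp_all
        moreover have "\<psi> f \<noteq> e" using \<psi> f e0 by (auto simp: bij_betw_def inj_on_def)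
        ultimately have "(\<theta> y, \<theta> z) \<in> ?L"
          using \<theta>K[OF yz(1)] \<theta>K[OF yz(2)] \<psi>EK[OF f(1)] by blast
        then show ?case using step.IH by (rule rtrancl_into_rtrancl[rotated])
      qed simp
      then show ?thesis using vw by simp
    qed
    show "F \<inter> F' = f" if F: "F \<in> K" "F' \<in> K" "F \<noteq> F'" and f: "f \<in> EK" "f \<subseteq> F" "f \<subseteq> F'" for F F' f
    proof -
      obtain e where e: "e \<in> E" "f = \<psi> e" using \<psi>E f by blast
      obtain v w where vw: "v \<in> V" "F = \<theta> v" "w \<in> V" "F' = \<theta> w" using \<theta>E F(1,2) by metis
      then have vwe: "v \<in> e" "w \<in> e" "v \<noteq> w" using side e f F(3) by auto
      then have eV: "e \<inter> V = {v, w}" using two_ends e vw by blast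
      have unique: "e' = e" if "e' \<in> E" "v \<in> e'" "w \<in> e'" for e'
        using two_ends[of e' v w] that vw vwe(3) eV edges_eqI[OF graph_M that(1) e(1)] by blast
      \<comment> \<open>\<open>y\<close> lies on boundary edges \<open>f1\<close> of
        \<open>F\<close> and \<open>f2\<close> of \<open>F'\<close>. If they coincide, simplicity of
        the primal graph makes this edge \<open>f\<close>; otherwise \<open>y\<close> is a dual
        vertex \<open>\<phi> H\<close> with \<open>v\<close> and \<open>w\<close> on
        \<open>H\<close>.\<close>
      have "y \<in> f" if y: "y \<in> F" "y \<in> F'" for y
      proof -
        obtain f1 where f1: "f1 \<in> EK" "y \<in> f1" "f1 \<subseteq> F"
          using faces_Int_on_graph[OF map_K, of F F' y] F y unfolding K_def by blast
        obtain f2 where f2: "f2 \<in> EK" "y \<in> f2" "f2 \<subseteq> F'"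
          using faces_Int_on_graph[OF map_K, of F' F y] F y unfolding K_def by blast
        obtain e1 where e1: "e1 \<in> E" "f1 = \<psi> e1" using \<psi>E f1 by blast
        show ?thesis
        proof (cases "f1 = f2")
          case True
          then have "e1 = e" using unique[OF e1(1)] side[OF _ e1(1)] f1 f2 e1 vw by blast
          then show ?thesis using f1 e1 e by simp
        next
          case False
          then have "y \<in> VK" using edges_Int[OF graph_K f1(1) f2(1)] f1 f2 by blast
          then obtain H where H: "H \<in> M" "y = \<phi> H" using \<phi>E by blast
          then have vH: "v \<in> H" "w \<in> H" using incid y vw by auto
          have "\<psi> e \<inter> VK \<noteq> {}" using edge_ends[OF graph_K \<psi>EK[OF e(1)]] by auto
          then obtain G where G: "G \<in> M" "e \<subseteq> G" using ends[OF e(1)] by auto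
          \<comment> \<open>Two different primal faces sharing \<open>v\<close> and \<open>w\<close>
            intersect in an edge by polyhedrality, and \<open>e\<close> is the only edge joining
            these vertices.\<close>
          have "e \<subseteq> H"
          proof (cases "G = H")
            case False
            then have "H \<inter> G = {} \<or> (\<exists>v\<in>V. H \<inter> G = {v}) \<or> H \<inter> G \<in> E"
              using P H(1) G(1) unfolding polyhedral_map_def M_def by metis
            moreover have "v \<in> H \<inter> G" "w \<in> H \<inter> G" using vH vwe G by auto
            ultimately have "H \<inter> G \<in> E" using vwe(3) by (metis empty_iff singletonD)
            then have "H \<inter> G = e" using unique \<open>v \<in> H \<inter> G\<close> \<open>w \<in> H \<inter> G\<close> by blast
            then show ?thesis by blast
          qed (use G in simp)
          then show ?thesis using end_iff[OF e(1) H(1)] H(2) e(2) by simp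
        qed
      qed
      then show ?thesis using f by blast
    qed
  qed
qed

theorem theorem5:
  fixes X :: "'a topology" and V VK :: "'a set" and E EK :: "'a set set" and n :: nat
  assumes "polyhedral_map X V E" and "card V = n"
    and "is_dual_map X V E VK EK"
  shows "(\<exists>W A. proper_tree X VK EK n W A) \<longleftrightarrow> (\<exists>W A. proper_graph_type_II X VK EK n W A)"
proof
  assume "\<exists>W A. proper_tree X VK EK n W A"
  then show "\<exists>W A. proper_graph_type_II X VK EK n W A"
    using proper_tree_imp_type_II[OF dual_polyhedral_incidence(1)[OF assms(1,3)]]
      dual_polyhedral_incidence(2)[OF assms(1,3)] assms(2) by blast
next
  assume "\<exists>W A. proper_graph_type_II X VK EK n W A"
  then show "\<exists>W A. proper_tree X VK EK n W A"
    by (auto simp: proper_graph_type_II_def)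
qed

end
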